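(* Let $p \in [1,\infty)$. Let $H$ be a finitely generated group with finite generating set $S_H$, of growth at least polynomial of degree $d > 2p$; if $H$ is of superpolynomial growth, assume moreover that $\mathcal{H}\mathrm{D}^q(H) \cap \ell^\infty(H)$ contains only constant functions for some $q > p$. Let $C$ be a group which is not finitely generated, let $\phi: H \to \mathrm{Aut}(C)$, $z \mapsto \phi_z$, be an action, and assume $G = C \rtimes_\phi H$ is finitely generated. Let $S_C \subset C$ be a finite set such that $\{\phi_z(c) \mid z \in H, c \in S_C\}$ generates $C$, and assume the following hypothesis holds: for every finite $F \subset H$ there are infinitely many $z \in H$ for which there exists $s \in S_C$ such that $\phi_z(s)$ is not in the subgroup generated by $\{\phi_w(c) \mid w \in F, c \in S_C\}$ and $[\phi_z(s), \phi_w(s')] = 1$ for all $w \in F$ and all $s' \in S_C$. Then $\mathcal{H}\mathrm{D}^p(G)$ (with respect to any finite generating set of $G$) contains only constant functions.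
   Context: For a finitely generated group $K$ with finite generating set $S$, its Cayley graph $\Gamma=(X,E)$ has vertex set $X = K$ and edges $E = \{(x,y) : x^{-1}y \in S \cup S^{-1}\}$. The gradient of $f: X \to \mathbb{R}$ is $\nabla f : E \to \mathbb{R}$, $\nabla f(x,y) = f(y) - f(x)$. For $p \in [1,\infty]$, $\mathrm{D}^p(\Gamma) = \{f: X \to \mathbb{R} \mid \nabla f \in \ell^p(E)\}$. Harmonic functions are the elements of $\ker(\nabla^*\nabla)$, i.e. functions whose value at each vertex is the average of the values at its neighbours. $\mathcal{H}\mathrm{D}^p(\Gamma)$ is the space of harmonic functions belonging to $\mathrm{D}^p(\Gamma)$. One writes $\mathrm{D}^p(K)$, $\mathcal{H}\mathrm{D}^p(K)$ for these spaces on the Cayley graph of $K$ for the chosen finite generating set; for $H$ the generating set is $S_H$. Elements of $G = C\rtimes_\phi H$ are pairs $(c,z)$ with product $(c,z)(c',z') = (c\,\phi_z(c'), zz')$. Here $[a,b]$ denotes the commutator. *)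

theory Defs
  imports "HOL-Analysis.Analysis" "HOL-Library.Landau_Symbols" "HOL-Algebra.Bij" "HOL-Algebra.Generated_Groups"
begin

definition generates :: "('a, 'm) monoid_scheme \<Rightarrow> 'a set \<Rightarrow> bool" where
  "generates K S \<longleftrightarrow> S \<subseteq> carrier K \<and> generate K S = carrier K"

definition finitely_generated :: "('a, 'm) monoid_scheme \<Rightarrow> bool" where
  "finitely_generated K \<longleftrightarrow> (\<exists>S. finite S \<and> generates K S)"

definition cayley_edges :: "('a, 'm) monoid_scheme \<Rightarrow> 'a set \<Rightarrow> ('a \<times> 'a) set" where
  "cayley_edges K S = {(x, y). x \<in> carrier K \<and> y \<in> carrier K \<and>
     inv\<^bsub>K\<^esub> x \<otimes>\<^bsub>K\<^esub> y \<in> S \<union> set_inv\<^bsub>K\<^esub> S}"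

definition cayley_ball :: "('a, 'm) monoid_scheme \<Rightarrow> 'a set \<Rightarrow> nat \<Rightarrow> 'a set" where
  "cayley_ball K S n = {x. \<exists>k\<le>n. (\<one>\<^bsub>K\<^esub>, x) \<in> cayley_edges K S ^^ k}"

definition growth :: "('a, 'm) monoid_scheme \<Rightarrow> 'a set \<Rightarrow> nat \<Rightarrow> real" where
  "growth K S n = real (card (cayley_ball K S n))"

definition growth_at_least_degree :: "('a, 'm) monoid_scheme \<Rightarrow> 'a set \<Rightarrow> real \<Rightarrow> bool" where
  "growth_at_least_degree K S d \<longleftrightarrow> growth K S \<in> \<Omega>(\<lambda>n. real n powr d)"

definition superpolynomial_growth :: "('a, 'm) monoid_scheme \<Rightarrow> 'a set \<Rightarrow> bool" where
  "superpolynomial_growth K S \<longleftrightarrow> (\<forall>k::nat. growth K S \<notin> O(\<lambda>n. real n ^ k))"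

definition ell :: "ereal \<Rightarrow> 'a set \<Rightarrow> ('a \<Rightarrow> real) set" where
  "ell p A = (if p = \<infinity> then {g. bounded (g ` A)}
     else {g. (\<lambda>a. \<bar>g a\<bar> powr real_of_ereal p) summable_on A})"

definition grad :: "('a \<Rightarrow> real) \<Rightarrow> 'a \<times> 'a \<Rightarrow> real" where
  "grad f = (\<lambda>(x, y). f y - f x)"

text \<open>The formal adjoint of the gradient, with respect to the pairings
  \<open>\<Sum>x. f x * h x\<close> on vertices and \<open>\<Sum>e\<in>E. g e * k e\<close> on oriented edges
  (each unoriented edge occurs in \<open>E\<close> with both orientations).\<close>

definition grad_adj :: "('a \<times> 'a) set \<Rightarrow> ('a \<times> 'a \<Rightarrow> real) \<Rightarrow> 'a \<Rightarrow> real" where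
  "grad_adj E g x = (\<Sum>y | (y, x) \<in> E. g (y, x)) - (\<Sum>y | (x, y) \<in> E. g (x, y))"

definition Dp :: "ereal \<Rightarrow> ('a, 'm) monoid_scheme \<Rightarrow> 'a set \<Rightarrow> ('a \<Rightarrow> real) set" where
  "Dp p K S = {f. grad f \<in> ell p (cayley_edges K S)}"

definition harmonic :: "('a, 'm) monoid_scheme \<Rightarrow> 'a set \<Rightarrow> ('a \<Rightarrow> real) set" where
  "harmonic K S = {f. \<forall>x\<in>carrier K. grad_adj (cayley_edges K S) (grad f) x = 0}"

definition HDp :: "ereal \<Rightarrow> ('a, 'm) monoid_scheme \<Rightarrow> 'a set \<Rightarrow> ('a \<Rightarrow> real) set" where
  "HDp p K S = harmonic K S \<inter> Dp p K S"

lemma grad_adj_pairing: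
  assumes "finite V" "E \<subseteq> V \<times> V"
  shows "(\<Sum>e\<in>E. grad f e * g e) = (\<Sum>x\<in>V. f x * grad_adj E g x)"
proof -
  have fin: "finite E" using assms finite_subset by blast
  have 1: "(\<Sum>(x, y)\<in>E. f y * g (x, y)) = (\<Sum>y\<in>V. \<Sum>x | (x, y) \<in> E. f y * g (x, y))"
  proof -
    have "(\<Sum>(x, y)\<in>E. f y * g (x, y)) =
        (\<Sum>(y, x)\<in>Sigma V (\<lambda>y. {x. (x, y) \<in> E}). f y * g (x, y))"
      by (rule sum.reindex_bij_witness[of _ prod.swap prod.swap]) (use assms in auto)
    also have "\<dots> = (\<Sum>y\<in>V. \<Sum>x | (x, y) \<in> E. f y * g (x, y))"
      by (rule sum.Sigma[symmetric])
         (use assms in \<open>auto intro: finite_subset[of _ V]\<close>)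
    finally show ?thesis .
  qed
  have 2: "(\<Sum>(x, y)\<in>E. f x * g (x, y)) = (\<Sum>x\<in>V. \<Sum>y | (x, y) \<in> E. f x * g (x, y))"
  proof -
    have "E = Sigma V (\<lambda>x. {y. (x, y) \<in> E})" using assms by auto
    then have "(\<Sum>(x, y)\<in>E. f x * g (x, y)) =
        (\<Sum>(x, y)\<in>Sigma V (\<lambda>x. {y. (x, y) \<in> E}). f x * g (x, y))" by simp
    also have "\<dots> = (\<Sum>x\<in>V. \<Sum>y | (x, y) \<in> E. f x * g (x, y))"
      by (rule sum.Sigma[symmetric])
         (use assms in \<open>auto intro: finite_subset[of _ V]\<close>)
    finally show ?thesis .
  qed
  have "(\<Sum>e\<in>E. grad f e * g e) =
      (\<Sum>(x, y)\<in>E. f y * g (x, y)) - (\<Sum>(x, y)\<in>E. f x * g (x, y))"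
    unfolding sum_subtractf[symmetric]
    by (intro sum.cong) (auto simp: grad_def algebra_simps)
  then show ?thesis
    by (simp only: 1 2)
       (simp add: grad_adj_def right_diff_distrib sum_subtractf sum_distrib_left)
qed

lemma (in group) cayley_edges_sym:
  assumes "S \<subseteq> carrier G" "(x, y) \<in> cayley_edges G S"
  shows "(y, x) \<in> cayley_edges G S"
proof -
  have xy: "x \<in> carrier G" "y \<in> carrier G" "inv x \<otimes> y \<in> S \<union> set_inv S"
    using assms by (auto simp: cayley_edges_def)
  have "inv y \<otimes> x = inv (inv x \<otimes> y)" using xy by (simp add: inv_mult_group)
  also have "\<dots> \<in> S \<union> set_inv S"
    using xy(3) assms(1) by (auto simp: SET_INV_def)
  finally show ?thesis using xy by (simp add: cayley_edges_def)
qed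

lemma (in group) harmonic_iff_mean_value:
  assumes "S \<subseteq> carrier G"
  shows "f \<in> harmonic G S \<longleftrightarrow> (\<forall>x\<in>carrier G.
    real (card {y. (x, y) \<in> cayley_edges G S}) * f x = (\<Sum>y | (x, y) \<in> cayley_edges G S. f y))"
proof -
  have "{y. (y, x) \<in> cayley_edges G S} = {y. (x, y) \<in> cayley_edges G S}" for x
    using cayley_edges_sym[OF assms] by blast
  then show ?thesis
    by (auto simp: harmonic_def grad_adj_def grad_def sum_subtractf mult.commute)
qed

definition semidirect :: "('c, 'm) monoid_scheme \<Rightarrow> ('h, 'k) monoid_scheme \<Rightarrow>
    ('h \<Rightarrow> 'c \<Rightarrow> 'c) \<Rightarrow> ('c \<times> 'h) monoid" where
  "semidirect C H \<phi> =
    \<lparr>carrier = carrier C \<times> carrier H,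
     mult = (\<lambda>(c, z) (c', z'). (c \<otimes>\<^bsub>C\<^esub> \<phi> z c', z \<otimes>\<^bsub>H\<^esub> z')),
     one = (\<one>\<^bsub>C\<^esub>, \<one>\<^bsub>H\<^esub>)\<rparr>"

lemma group_semidirect:
  assumes "group C" "group H" and hom: "\<phi> \<in> hom H (AutoGroup C)"
  shows "group (semidirect C H \<phi>)"
proof -
  interpret C: group C by fact
  interpret H: group H by fact
  have A: "\<phi> z \<in> auto C" if "z \<in> carrier H" for z
    using hom that by (auto simp: hom_def AutoGroup_def)
  have cl: "\<phi> z c \<in> carrier C" if "z \<in> carrier H" "c \<in> carrier C" for z c
    using A[OF that(1)] that(2) by (auto simp: auto_def hom_def)
  have m: "\<phi> z (c \<otimes>\<^bsub>C\<^esub> c') = \<phi> z c \<otimes>\<^bsub>C\<^esub> \<phi> z c'"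
    if "z \<in> carrier H" "c \<in> carrier C" "c' \<in> carrier C" for z c c'
    using A[OF that(1)] that(2,3) by (auto simp: auto_def hom_def)
  have comp: "\<phi> (z \<otimes>\<^bsub>H\<^esub> w) c = \<phi> z (\<phi> w c)"
    if "z \<in> carrier H" "w \<in> carrier H" "c \<in> carrier C" for z w c
    using hom A[OF that(1)] A[OF that(2)] that
    by (auto simp: hom_def AutoGroup_def BijGroup_def auto_def compose_def)
  have one: "\<phi> \<one>\<^bsub>H\<^esub> c = c" if c: "c \<in> carrier C" for c
  proof -
    have "inj_on (\<phi> \<one>\<^bsub>H\<^esub>) (carrier C)"
      using A[OF H.one_closed] by (auto simp: auto_def Bij_def bij_betw_def)
    moreover have "\<phi> \<one>\<^bsub>H\<^esub> (\<phi> \<one>\<^bsub>H\<^esub> c) = \<phi> \<one>\<^bsub>H\<^esub> c"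
      using comp[of "\<one>\<^bsub>H\<^esub>" "\<one>\<^bsub>H\<^esub>" c] c by simp
    ultimately show ?thesis using c cl by (auto dest: inj_onD)
  qed
  show ?thesis
  proof (rule groupI)
    fix x assume "x \<in> carrier (semidirect C H \<phi>)"
    then obtain c z where x: "x = (c, z)" "c \<in> carrier C" "z \<in> carrier H"
      by (auto simp: semidirect_def)
    let ?y = "(\<phi> (inv\<^bsub>H\<^esub> z) (inv\<^bsub>C\<^esub> c), inv\<^bsub>H\<^esub> z)"
    have "\<phi> (inv\<^bsub>H\<^esub> z) \<one>\<^bsub>C\<^esub> = \<one>\<^bsub>C\<^esub>"
      using m[of "inv\<^bsub>H\<^esub> z" "\<one>\<^bsub>C\<^esub>" "\<one>\<^bsub>C\<^esub>"] cl x by simp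
    then have "?y \<otimes>\<^bsub>semidirect C H \<phi>\<^esub> x = \<one>\<^bsub>semidirect C H \<phi>\<^esub>"
      using x by (simp add: semidirect_def m[symmetric])
    moreover have "?y \<in> carrier (semidirect C H \<phi>)"
      using x cl by (simp add: semidirect_def)
    ultimately show "\<exists>y\<in>carrier (semidirect C H \<phi>).
        y \<otimes>\<^bsub>semidirect C H \<phi>\<^esub> x = \<one>\<^bsub>semidirect C H \<phi>\<^esub>" by blast
  qed (auto simp: semidirect_def cl m comp one C.m_assoc H.m_assoc)
qed

definition commutator :: "('a, 'm) monoid_scheme \<Rightarrow> 'a \<Rightarrow> 'a \<Rightarrow> 'a" where
  "commutator K a b = a \<otimes>\<^bsub>K\<^esub> b \<otimes>\<^bsub>K\<^esub> inv\<^bsub>K\<^esub> a \<otimes>\<^bsub>K\<^esub> inv\<^bsub>K\<^esub> b"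

end

theory Submission
  imports Defs "HOL-Real_Asymp.Real_Asymp"
begin

text \<open>
  Write \<open>G\<close> for the semidirect product. The cosets of \<open>H\<close> in \<open>G\<close> are the sets
  \<open>{c} \<times> H\<close>. If \<open>f\<close> has \<open>p\<close>-summable gradient on \<open>G\<close>, then so have its restrictions to these
  cosets, and their \<open>p\<close>-energies \<open>E c\<close> are summable over \<open>c \<in> C\<close>. Everything rests on a statement
  about \<open>H\<close> alone, \<open>limit_at_infinity\<close>: a function on \<open>H\<close> with \<open>p\<close>-energy \<open>E\<close> converges
  at infinity, and its distance to the limit is nowhere more than \<open>K * E powr (1 / p)\<close>, with \<open>K\<close>
  depending only on \<open>H\<close>, its generators and \<open>p\<close>.

  Hence \<open>f\<close> has a limit \<open>a c\<close> along the coset of \<open>c\<close>, and \<open>f\<close> is uniformly close to \<open>a c\<close> on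
  this coset for all but finitely many \<open>c\<close>. Right multiplication by \<open>(s, 1)\<close> leads from
  \<open>(c, z)\<close> to \<open>(c \<phi>\<^sub>z(s), z)\<close>, a step over which \<open>f\<close> changes by a \<open>p\<close>-summable amount. To compare
  \<open>a c\<close> with \<open>a (c b)\<close> for a generator \<open>b = \<phi>\<^sub>w(s')\<close> of \<open>C\<close>, take \<open>z\<close> far away such that
  \<open>u = \<phi>\<^sub>z(s)\<close> commutes with \<open>b\<close> and avoids a given finite set. The cosets of \<open>c\<close> and \<open>c u\<close> are
  adjacent over \<open>z\<close>, those of \<open>c u\<close> and \<open>c u b = c b u\<close> are adjacent over \<open>w\<close>, and those of
  \<open>c b u\<close> and \<open>c b\<close> again over \<open>z\<close>. At each of these crossings \<open>f\<close> is almost equal to the limits on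
  both sides, so \<open>a (c b) = a c\<close> (\<open>coset_limits_invariant\<close>). Therefore \<open>a\<close> is constant,
  \<open>f - a\<close> tends to zero at infinity of \<open>G\<close>, and if \<open>f\<close> is harmonic, the maximum principle makes
  it constant (\<open>harmonic_vanishing_at_infinity\<close>).

  To find the limit of a function \<open>g\<close> on \<open>H\<close>, average it along the lazy simple random walk.
  Growth of degree \<open>d\<close> gives a Nash inequality, and with it the bound
  \<open>n powr (- d / 2)\<close> on the \<open>n\<close>-step transition probabilities (\<open>walk_decay\<close>). Each averaging
  step then changes \<open>g\<close> by at most a constant times \<open>n powr (- d / (2 * p)) * E powr (1 / p)\<close>,
  which is summable because \<open>d > 2 * p\<close>. So the averages converge to a harmonic function, the
  boundary extension of \<open>g\<close>, which differs from \<open>g\<close> by a function tending to zero. It remains to see that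
  the boundary extension is constant. It suffices to consider bounded \<open>g\<close>, because truncation does not
  increase the energy and the bound on the distance does not depend on \<open>g\<close> otherwise. There are two cases.

  If \<open>H\<close> has growth of at least every polynomial degree, the averages converge so fast that the
  boundary extension has \<open>q\<close>-summable gradient for every \<open>q > p\<close>
  (\<open>boundary_extension_q_summable\<close>), and the hypothesis on bounded harmonic functions applies.

  Otherwise some degree is not reached, and along a sequence of radii the balls are polynomially
  small. The entropy of the walk after \<open>n\<close> steps is at most the logarithm of the size of the
  \<open>n\<close>-ball, so it has arbitrarily small increments. An increment of the entropy controls
  the distance between the distributions of the walk started at two neighbours, and all bounded
  harmonic functions are constant (\<open>bounded_harmonic_constant\<close>). Splitting in this way, and not into
  polynomial and superpolynomial growth, avoids Gromov's theorem: growth that is large only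
  along a sequence of radii falls into the second case.
\<close>

section \<open>Inequalities and summable families\<close>

lemma convex_on_powr_nonneg:
  assumes p: "1 \<le> (p::real)"
  shows "convex_on {0..} (\<lambda>x. x powr p)"
proof (rule convex_onI)
  fix t x y :: real
  assume t: "0 < t" "t < 1" and xy: "x \<in> {0..}" "y \<in> {0..}"
  have scale: "(s * z) powr p \<le> s * z powr p" if "0 < s" "s < 1" "0 \<le> z" for s z :: real
  proof -
    have "s powr p \<le> s powr 1" using that p by (intro powr_mono') auto
    then show ?thesis using that by (simp add: powr_mult mult_right_mono)
  qed
  show "((1 - t) *\<^sub>R x + t *\<^sub>R y) powr p \<le> (1 - t) * x powr p + t * y powr p"
  proof (cases "x = 0 \<or> y = 0")
    case True
    then show ?thesis using scale[of t y] scale[of "1 - t" x] t xy by auto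
  next
    case False
    then show ?thesis using convex_onD[OF powr_convex[OF p], of t x y] t xy by auto
  qed
qed simp

text \<open>Jensen's inequality. The weights need not add up to one, which allows infinite weighted sums to be
  treated through their partial sums.\<close>
lemma powr_sum_le:
  fixes w a :: "'i \<Rightarrow> real"
  assumes p: "1 \<le> p" and fin: "finite I" and w: "\<And>i. i \<in> I \<Longrightarrow> 0 \<le> w i" and W: "sum w I \<le> W"
  shows "\<bar>\<Sum>i\<in>I. w i * a i\<bar> powr p \<le> W powr (p - 1) * (\<Sum>i\<in>I. w i * \<bar>a i\<bar> powr p)"
proof (cases "sum w I = 0")
  case True
  then have "\<And>i. i \<in> I \<Longrightarrow> w i = 0" using fin w sum_nonneg_eq_0_iff[of I w] by auto
  then show ?thesis by simp
next
  case False
  define U where "U = sum w I"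
  have U: "U > 0" using False w sum_nonneg[of I w] by (simp add: U_def order_less_le)
  have ne: "I \<noteq> {}" using False by auto
  have "(\<Sum>i\<in>I. (w i / U) *\<^sub>R \<bar>a i\<bar>) powr p \<le> (\<Sum>i\<in>I. (w i / U) * \<bar>a i\<bar> powr p)"
    by (rule convex_on_sum[OF fin ne convex_on_powr_nonneg[OF p]])
       (use U w in \<open>auto simp: U_def sum_divide_distrib[symmetric]\<close>)
  then have J: "((\<Sum>i\<in>I. w i * \<bar>a i\<bar>) / U) powr p \<le> (\<Sum>i\<in>I. w i * \<bar>a i\<bar> powr p) / U"
    by (simp add: sum_divide_distrib)
  have nn: "0 \<le> (\<Sum>i\<in>I. w i * \<bar>a i\<bar>)" "0 \<le> (\<Sum>i\<in>I. w i * \<bar>a i\<bar> powr p)"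
    using w by (auto intro!: sum_nonneg)
  have "\<bar>\<Sum>i\<in>I. w i * a i\<bar> \<le> (\<Sum>i\<in>I. w i * \<bar>a i\<bar>)"
    by (rule order_trans[OF sum_abs]) (auto intro!: sum_mono simp: abs_mult w)
  then have "\<bar>\<Sum>i\<in>I. w i * a i\<bar> powr p \<le> (\<Sum>i\<in>I. w i * \<bar>a i\<bar>) powr p"
    using p by (intro powr_mono2) auto
  also have "\<dots> = U powr p * ((\<Sum>i\<in>I. w i * \<bar>a i\<bar>) / U) powr p"
    using U nn by (simp add: powr_divide)
  also have "\<dots> \<le> U powr p * ((\<Sum>i\<in>I. w i * \<bar>a i\<bar> powr p) / U)"
    by (intro mult_left_mono J) simp
  also have "\<dots> = U powr (p - 1) * (\<Sum>i\<in>I. w i * \<bar>a i\<bar> powr p)"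
    using U by (simp add: powr_diff)
  also have "\<dots> \<le> W powr (p - 1) * (\<Sum>i\<in>I. w i * \<bar>a i\<bar> powr p)"
    using U W p nn by (intro mult_right_mono powr_mono2) (auto simp: U_def)
  finally show ?thesis .
qed

lemma powr_add_le:
  fixes a b :: real
  assumes "0 \<le> p"
  shows "\<bar>a + b\<bar> powr p \<le> 2 powr p * (\<bar>a\<bar> powr p + \<bar>b\<bar> powr p)"
proof -
  have "\<bar>a + b\<bar> powr p \<le> (2 * max \<bar>a\<bar> \<bar>b\<bar>) powr p"
    using assms by (intro powr_mono2) auto
  also have "\<dots> = 2 powr p * max \<bar>a\<bar> \<bar>b\<bar> powr p" by (simp add: powr_mult)
  also have "\<dots> \<le> 2 powr p * (\<bar>a\<bar> powr p + \<bar>b\<bar> powr p)"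
    by (intro mult_left_mono) (auto simp: max_def)
  finally show ?thesis .
qed

lemma has_sum_finite_sum:
  fixes f :: "'i \<Rightarrow> 'x \<Rightarrow> real"
  assumes "finite I" "\<And>i. i \<in> I \<Longrightarrow> f i summable_on A"
  shows "((\<lambda>x. \<Sum>i\<in>I. f i x) has_sum (\<Sum>i\<in>I. infsum (f i) A)) A"
  using assms by (induction I rule: finite_induct) (auto intro!: has_sum_add has_sum_infsum)

lemma nonneg_summable_on_leI:
  fixes f g :: "'i \<Rightarrow> real"
  assumes "g summable_on A" "\<And>x. x \<in> A \<Longrightarrow> 0 \<le> f x" "\<And>x. x \<in> A \<Longrightarrow> f x \<le> g x"
  shows "f summable_on A"
  using assms by (intro summable_on_comparison_test[of g A f]) auto

lemma finite_level_set_of_summable: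
  fixes f :: "'i \<Rightarrow> real"
  assumes f: "f summable_on A" "\<And>x. x \<in> A \<Longrightarrow> 0 \<le> f x" and e: "e > 0"
  shows "finite {x \<in> A. f x \<ge> e}"
proof (rule finite_if_finite_subsets_card_bdd[THEN conjunct1])
  fix F assume F: "F \<subseteq> {x \<in> A. f x \<ge> e}" "finite F"
  have "real (card F) * e \<le> sum f F"
    using sum_bounded_below[of F e f] F(1) by auto
  also have "\<dots> \<le> infsum f A"
    by (rule finite_sum_le_infsum) (use F f in auto)
  finally have "real (card F) \<le> infsum f A / e" using e by (simp add: field_simps)
  then show "card F \<le> nat \<lceil>infsum f A / e\<rceil>" by linarith
qed

lemma finite_level_set_of_powr_summable:
  fixes f :: "'i \<Rightarrow> real"
  assumes "(\<lambda>x. \<bar>f x\<bar> powr p) summable_on A" "e > 0" "0 \<le> p"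
  shows "finite {x \<in> A. \<bar>f x\<bar> \<ge> e}"
  using assms
  by (intro finite_subset[OF _ finite_level_set_of_summable[OF assms(1), of "e powr p"]])
     (auto intro: powr_mono2)

text \<open>The discrete form of the differential inequality \<open>- u' \<ge> c * u powr (1 + 2 / d)\<close>. Summing the
  recursion over \<open>{m..<2 * m}\<close> bounds \<open>u (2 * m)\<close> by
  \<open>(A * r\<^sup>2 / m) * u m + B * r powr - d\<close>. With \<open>r\<^sup>2\<close> a small multiple of \<open>m\<close> both terms are of the
  right order, and the first has a small enough constant for an induction along doublings.\<close>
lemma polynomial_decay_of_nash_recursion:
  fixes u :: "nat \<Rightarrow> real"
  assumes dec: "\<And>n. u (Suc n) \<le> u n" and nn: "\<And>n. 0 \<le> u n"
    and A: "A > 0" and B: "B \<ge> 0" and d: "d > 0"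
    and rec: "\<And>n r. 1 \<le> r \<Longrightarrow> u n \<le> A * real r ^ 2 * (u n - u (Suc n)) + B * real r powr - d"
  shows "\<exists>K. \<forall>n\<ge>1. u n \<le> K * real n powr - (d / 2)"
proof -
  define \<beta> where "\<beta> = d / 2"
  have \<beta>: "\<beta> > 0" "d = 2 * \<beta>" using d by (auto simp: \<beta>_def)
  have mono: "u n \<le> u m" if "m \<le> n" for m n
    using lift_Suc_antimono_le[of u, OF _ that] dec by auto
  have double: "u (2 * m) \<le> A * real r ^ 2 / real m * u m + B * real r powr - d"
    if "1 \<le> m" "1 \<le> r" for m r
  proof -
    have "real m * u (2 * m) = (\<Sum>j\<in>{m..<2*m}. u (2 * m))" by simp
    also have "\<dots> \<le> (\<Sum>j\<in>{m..<2*m}. u j)" by (intro sum_mono mono) auto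
    also have "\<dots> \<le> (\<Sum>j\<in>{m..<2*m}. A * real r ^ 2 * (u j - u (Suc j)) + B * real r powr - d)"
      by (intro sum_mono rec that)
    also have "\<dots> = A * real r ^ 2 * (\<Sum>j\<in>{m..<2*m}. u j - u (Suc j)) + real m * (B * real r powr - d)"
      by (simp add: sum.distrib sum_distrib_left)
    also have "(\<Sum>j\<in>{m..<2*m}. u j - u (Suc j)) = u m - u (2 * m)"
      using sum_Suc_diff'[of m "2 * m" "\<lambda>j. - u j"] by simp
    also have "A * real r ^ 2 * (u m - u (2 * m)) \<le> A * real r ^ 2 * u m"
      using A nn[of "2 * m"] by (intro mult_left_mono) auto
    finally have "real m * u (2 * m) \<le> A * real r ^ 2 * u m + real m * (B * real r powr - d)" by simp
    then show ?thesis using that by (simp add: field_simps)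
  qed
  \<comment> \<open>The constant is such that \<open>A * (4 * \<kappa>) * 3 powr \<beta> = 1 / 2\<close>: the factor 3 accounts for \<open>n div 2 \<ge> n / 3\<close>, the factor 4
      for rounding up \<open>sqrt (\<kappa> * m)\<close>. Below \<open>n0\<close> this rounding is useless and \<open>K\<close> is taken large enough.\<close>
  define \<kappa> where "\<kappa> = 1 / (8 * A * 3 powr \<beta>)"
  define n0 where "n0 = 2 / \<kappa> + 2"
  define B' where "B' = B * \<kappa> powr - \<beta> * 3 powr \<beta>"
  define K where "K = max (2 * B') (u 0 * n0 powr \<beta>)"
  have \<kappa>: "\<kappa> > 0" using A by (simp add: \<kappa>_def)
  have "u n \<le> K * real n powr - \<beta>" if "n \<ge> 1" for n
    using that
  proof (induction n rule: less_induct)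
    case (less n)
    define m where "m = n div 2"
    have nm: "n \<le> 2 * m + 1" "2 * m \<le> n" by (auto simp: m_def)
    then have nm': "real n \<le> 2 * real m + 1" "2 * real m \<le> real n" by linarith+
    show ?case
    proof (cases "\<kappa> * real m < 1")
      case True
      then have "real m < 1 / \<kappa>" using \<kappa> by (simp add: field_simps)
      then have "real n \<le> n0" using nm'(1) by (simp add: n0_def)
      then have "n0 powr \<beta> * real n powr - \<beta> \<ge> 1"
        using powr_mono2[of \<beta> "real n" n0] \<beta> less.prems
        by (simp add: powr_minus field_simps)
      then have "u 0 * 1 \<le> u 0 * (n0 powr \<beta> * real n powr - \<beta>)"
        using nn by (intro mult_left_mono) auto
      also have "\<dots> \<le> K * real n powr - \<beta>"
        unfolding mult.assoc[symmetric] by (intro mult_right_mono) (auto simp: K_def)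
      finally show ?thesis using mono[of 0 n] by simp
    next
      case False
      then have "m \<ge> 1" using \<kappa> by (cases "m = 0") auto
      then have m1: "m \<ge> 1" "m < n" using nm by auto
      define r where "r = nat \<lceil>sqrt (\<kappa> * real m)\<rceil>"
      have s1: "sqrt (\<kappa> * real m) \<ge> 1" using False by simp
      then have r: "1 \<le> r" "sqrt (\<kappa> * real m) \<le> real r" "real r \<le> 2 * sqrt (\<kappa> * real m)"
        unfolding r_def by linarith+
      have r2: "real r ^ 2 \<le> 4 * \<kappa> * real m"
        using power_mono[OF r(3), of 2] \<kappa> by (simp add: power_mult_distrib)
      have "real r powr - d \<le> sqrt (\<kappa> * real m) powr - d"
        using r s1 d by (intro powr_mono2') auto
      also have "\<dots> = (\<kappa> * real m) powr - \<beta>"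
        using \<kappa> by (simp add: powr_half_sqrt[symmetric] powr_powr \<beta>(2))
      finally have rd: "real r powr - d \<le> \<kappa> powr - \<beta> * real m powr - \<beta>"
        by (simp add: powr_mult)
      have m3: "real m powr - \<beta> \<le> 3 powr \<beta> * real n powr - \<beta>"
      proof -
        have "real n / 3 \<le> real m" using m1(1) nm' by simp
        then have "real m powr - \<beta> \<le> (real n / 3) powr - \<beta>"
          using less.prems \<beta> by (intro powr_mono2') auto
        then show ?thesis using less.prems by (simp add: powr_divide powr_minus field_simps)
      qed
      have "u n \<le> u (2 * m)" by (rule mono[OF nm(2)])
      also have "\<dots> \<le> A * real r ^ 2 / real m * u m + B * real r powr - d"
        by (rule double[OF m1(1) r(1)])
      also have "\<dots> \<le> A * (4 * \<kappa>) * u m + B * (\<kappa> powr - \<beta> * real m powr - \<beta>)"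
      proof (intro add_mono mult_right_mono mult_left_mono rd B nn)
        show "A * real r ^ 2 / real m \<le> A * (4 * \<kappa>)"
          using r2 A m1 by (simp add: field_simps)
      qed
      also have "\<dots> \<le> A * (4 * \<kappa>) * (K * real m powr - \<beta>) + B * (\<kappa> powr - \<beta> * real m powr - \<beta>)"
        using less.IH[OF m1(2,1)] A \<kappa> B by (intro add_mono mult_left_mono) auto
      also have "\<dots> = (A * (4 * \<kappa>) * K + B * \<kappa> powr - \<beta>) * real m powr - \<beta>"
        by (simp add: algebra_simps)
      also have "\<dots> \<le> (A * (4 * \<kappa>) * K + B * \<kappa> powr - \<beta>) * (3 powr \<beta> * real n powr - \<beta>)"
        using A \<kappa> B nn[of 0] by (intro mult_left_mono m3 add_nonneg_nonneg mult_nonneg_nonneg) (auto simp: K_def intro!: max.coboundedI2)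
      also have "\<dots> = (A * (4 * \<kappa>) * 3 powr \<beta> * K + B') * real n powr - \<beta>"
        by (simp add: algebra_simps B'_def)
      also have "A * (4 * \<kappa>) * 3 powr \<beta> = 1 / 2"
        using A by (simp add: \<kappa>_def)
      also have "(1 / 2 * K + B') * real n powr - \<beta> \<le> K * real n powr - \<beta>"
        by (intro mult_right_mono) (auto simp: K_def)
      finally show ?thesis .
    qed
  qed
  then show ?thesis unfolding \<beta>_def by blast
qed

text \<open>Summed over a probability space, this bounds the relative entropy below by the squared Hellinger
  distance. Pointwise it is \<open>ln x \<le> x - 1\<close> at \<open>x = sqrt (b / a)\<close>.\<close>
lemma relative_entropy_ge_hellinger:
  fixes a b :: real
  assumes "0 \<le> a" "0 \<le> b" "b = 0 \<Longrightarrow> a = 0"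
  shows "(sqrt a - sqrt b)\<^sup>2 + a - b \<le> a * ln a - a * ln b"
proof (cases "a = 0")
  case True
  then show ?thesis using assms by simp
next
  case False
  then have ab: "a > 0" "b > 0" using assms by (auto simp: less_le)
  have "ln (sqrt (b / a)) \<le> sqrt (b / a) - 1" using ab by (intro ln_le_minus_one) auto
  also have "ln (sqrt (b / a)) = (ln b - ln a) / 2" using ab by (simp add: ln_sqrt ln_div)
  finally have "2 * a * ((ln b - ln a) / 2) \<le> 2 * a * (sqrt (b / a) - 1)"
    using ab by (intro mult_left_mono) auto
  also have "2 * a * (sqrt (b / a) - 1) = 2 * (sqrt a * sqrt b) - 2 * a"
  proof -
    have "sqrt a * (sqrt b / sqrt a) = sqrt b" using ab by simp
    moreover have "a * sqrt (b / a) = sqrt a * (sqrt a * (sqrt b / sqrt a))"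
      using ab by (simp only: real_sqrt_divide mult.assoc[symmetric] real_sqrt_mult_self abs_of_pos)
    ultimately have "a * sqrt (b / a) = sqrt a * sqrt b" by simp
    then show ?thesis by (simp add: algebra_simps)
  qed
  also have "2 * a * ((ln b - ln a) / 2) = a * ln b - a * ln a" by (simp add: field_simps)
  finally have "a * ln b - a * ln a \<le> 2 * (sqrt a * sqrt b) - 2 * a" .
  moreover have "(sqrt a - sqrt b)\<^sup>2 = a + b - 2 * (sqrt a * sqrt b)"
    using ab by (simp add: power2_diff)
  ultimately show ?thesis by simp
qed

text \<open>A linearised Cauchy-Schwarz inequality for
  \<open>\<bar>a - b\<bar> = \<bar>sqrt a - sqrt b\<bar> * (sqrt a + sqrt b)\<close>. Summed over a probability space it says that
  distributions at small Hellinger distance are close in total variation; the free parameter \<open>l\<close>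
  replaces the square root of the Hellinger sum.\<close>
lemma abs_diff_le_hellinger:
  assumes "0 \<le> a" "0 \<le> b" "0 < (l::real)"
  shows "\<bar>a - b\<bar> \<le> l / 2 * (sqrt a - sqrt b)\<^sup>2 + 1 / l * (a + b)"
proof -
  define u where "u = \<bar>sqrt a - sqrt b\<bar>"
  define v where "v = sqrt a + sqrt b"
  have "\<bar>a - b\<bar> = \<bar>(sqrt a - sqrt b) * (sqrt a + sqrt b)\<bar>"
    using assms by (simp add: algebra_simps)
  also have "\<dots> = u * v" using assms by (simp add: abs_mult u_def v_def)
  also have "\<dots> \<le> l / 2 * u\<^sup>2 + 1 / (2 * l) * v\<^sup>2"
  proof -
    have "0 \<le> 1 / (2 * l) * (l * u - v)\<^sup>2" using assms by simp
    also have "\<dots> = l / 2 * u\<^sup>2 + 1 / (2 * l) * v\<^sup>2 - u * v"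
      using assms by (simp add: power2_eq_square field_simps)
    finally show ?thesis by simp
  qed
  also have "1 / (2 * l) * v\<^sup>2 \<le> 1 / (2 * l) * (2 * (a + b))"
  proof (intro mult_left_mono)
    have "v\<^sup>2 = a + b + 2 * sqrt a * sqrt b" using assms by (simp add: v_def power2_sum)
    also have "2 * sqrt a * sqrt b \<le> a + b"
      using sum_squares_bound[of "sqrt a" "sqrt b"] assms by simp
    finally show "v\<^sup>2 \<le> 2 * (a + b)" by simp
  qed (use assms in auto)
  also have "1 / (2 * l) * (2 * (a + b)) = 1 / l * (a + b)" using assms by (simp add: field_simps)
  finally show ?thesis by (simp add: u_def)
qed

section \<open>Cayley graphs of finitely generated groups\<close>

lemma (in group) bij_betw_right_translation:
  "y \<in> carrier G \<Longrightarrow> bij_betw (\<lambda>x. x \<otimes> y) (carrier G) (carrier G)"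
  by (rule bij_betw_byWitness[where f' = "\<lambda>x. x \<otimes> inv y"]) (auto simp: m_assoc)

lemma (in group) bij_betw_left_translation:
  "y \<in> carrier G \<Longrightarrow> bij_betw (\<lambda>x. y \<otimes> x) (carrier G) (carrier G)"
  by (rule bij_betw_byWitness[where f' = "\<lambda>x. inv y \<otimes> x"]) (auto simp: m_assoc[symmetric])

locale fg_group = group G for G (structure) +
  fixes S :: "'a set"
  assumes finite_S: "finite S" and generates_S: "generates G S"
begin

text \<open>The Cayley graph and the random walk depend on the generating set only through this symmetric set.\<close>
definition steps :: "'a set" where
  "steps = S \<union> set_inv S"

lemma S_subset: "S \<subseteq> carrier G"
  using generates_S by (simp add: generates_def)

lemma finite_steps [simp]: "finite steps"
  using finite_S by (simp add: steps_def SET_INV_def)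

lemma steps_closed [simp]: "t \<in> steps \<Longrightarrow> t \<in> carrier G"
  using S_subset by (auto simp: steps_def SET_INV_def)

lemma steps_inv [simp]: "t \<in> steps \<Longrightarrow> inv t \<in> steps"
  using S_subset by (auto simp: steps_def SET_INV_def)

lemma bij_betw_inv_steps: "bij_betw (\<lambda>t. inv t) steps steps"
  by (rule bij_betw_byWitness[where f' = "\<lambda>t. inv t"]) auto

text \<open>Every element is a word in the steps, and a word grows at its right end, that is, along edges of the
  Cayley graph.\<close>
lemma carrier_induct [consumes 1, case_names one step]:
  assumes "x \<in> carrier G" and "P \<one>"
    and step: "\<And>y t. y \<in> carrier G \<Longrightarrow> t \<in> steps \<Longrightarrow> P y \<Longrightarrow> P (y \<otimes> t)"
  shows "P x"
proof -
  have "y \<in> carrier G \<and> (\<forall>z\<in>carrier G. P z \<longrightarrow> P (z \<otimes> y))" if "y \<in> generate G S" for y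
    using that
  proof (induction rule: generate.induct)
    case (incl h)
    then show ?case using step S_subset by (auto simp: steps_def)
  next
    case (inv h)
    then show ?case using step S_subset by (auto simp: steps_def SET_INV_def)
  next
    case (eng h1 h2)
    then show ?case by (auto simp: m_assoc[symmetric])
  qed auto
  then have "P (\<one> \<otimes> x)"
    using assms(1,2) generates_S by (metis generates_def one_closed)
  then show ?thesis using assms(1) by simp
qed

lemma edge_iff: "(x, y) \<in> cayley_edges G S \<longleftrightarrow> x \<in> carrier G \<and> (\<exists>t\<in>steps. y = x \<otimes> t)"
proof
  assume "(x, y) \<in> cayley_edges G S"
  then show "x \<in> carrier G \<and> (\<exists>t\<in>steps. y = x \<otimes> t)"
    by (auto simp: cayley_edges_def steps_def m_assoc[symmetric] intro!: bexI[of _ "inv x \<otimes> y"])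
qed (auto simp: cayley_edges_def steps_def[symmetric] m_assoc[symmetric])

lemma bij_betw_edges:
  "bij_betw (\<lambda>(x, t). (x, x \<otimes> t)) (carrier G \<times> steps) (cayley_edges G S)"
  by (auto simp: bij_betw_def inj_on_def image_def edge_iff)

lemma harmonic_iff:
  "f \<in> harmonic G S \<longleftrightarrow>
    (\<forall>x\<in>carrier G. real (card steps) * f x = (\<Sum>t\<in>steps. f (x \<otimes> t)))"
proof -
  have "card {y. (x, y) \<in> cayley_edges G S} = card steps \<and>
      (\<Sum>y | (x, y) \<in> cayley_edges G S. f y) = (\<Sum>t\<in>steps. f (x \<otimes> t))"
    if x: "x \<in> carrier G" for x
  proof -
    have eq: "{y. (x, y) \<in> cayley_edges G S} = (\<lambda>t. x \<otimes> t) ` steps"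
      using x by (auto simp: edge_iff)
    have "inj_on (\<lambda>t. x \<otimes> t) steps" using x by (auto simp: inj_on_def)
    then show ?thesis by (simp add: eq card_image sum.reindex)
  qed
  then show ?thesis unfolding harmonic_iff_mean_value[OF S_subset] by simp
qed

lemma summable_right_translation:
  "y \<in> carrier G \<Longrightarrow> (\<lambda>x. \<phi> (x \<otimes> y)) summable_on carrier G \<longleftrightarrow> \<phi> summable_on carrier G"
  by (rule summable_on_reindex_bij_betw[OF bij_betw_right_translation])

lemma infsum_right_translation:
  "y \<in> carrier G \<Longrightarrow> (\<Sum>\<^sub>\<infinity>x\<in>carrier G. \<phi> (x \<otimes> y)) = infsum \<phi> (carrier G)"
  by (rule infsum_reindex_bij_betw[OF bij_betw_right_translation])

lemma summable_left_translation:
  "y \<in> carrier G \<Longrightarrow> (\<lambda>x. \<phi> (y \<otimes> x)) summable_on carrier G \<longleftrightarrow> \<phi> summable_on carrier G"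
  by (rule summable_on_reindex_bij_betw[OF bij_betw_left_translation])

lemma infsum_left_translation:
  "y \<in> carrier G \<Longrightarrow> (\<Sum>\<^sub>\<infinity>x\<in>carrier G. \<phi> (y \<otimes> x)) = infsum \<phi> (carrier G)"
  by (rule infsum_reindex_bij_betw[OF bij_betw_left_translation])

lemma Dp_iff:
  "f \<in> Dp (ereal p) G S \<longleftrightarrow>
    (\<forall>t\<in>steps. (\<lambda>x. \<bar>f (x \<otimes> t) - f x\<bar> powr p) summable_on carrier G)"
proof -
  have swap: "bij_betw prod.swap (steps \<times> carrier G) (carrier G \<times> steps)"
    by (auto simp: bij_betw_def inj_on_def)
  have "f \<in> Dp (ereal p) G S \<longleftrightarrow>
      (\<lambda>e. \<bar>grad f e\<bar> powr p) summable_on cayley_edges G S"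
    by (simp add: Dp_def ell_def)
  also have "\<dots> \<longleftrightarrow> (\<lambda>(x, t). \<bar>f (x \<otimes> t) - f x\<bar> powr p) summable_on carrier G \<times> steps"
    by (subst summable_on_reindex_bij_betw[OF bij_betw_edges, symmetric])
       (simp add: grad_def case_prod_unfold)
  also have "\<dots> \<longleftrightarrow> (\<lambda>(t, x). \<bar>f (x \<otimes> t) - f x\<bar> powr p) summable_on (SIGMA t:steps. carrier G)"
    by (subst summable_on_reindex_bij_betw[OF swap, symmetric]) (simp add: case_prod_unfold)
  also have "\<dots> \<longleftrightarrow> (\<forall>t\<in>steps. (\<lambda>x. \<bar>f (x \<otimes> t) - f x\<bar> powr p) summable_on carrier G)"
  proof
    assume "(\<lambda>(t, x). \<bar>f (x \<otimes> t) - f x\<bar> powr p) summable_on (SIGMA t:steps. carrier G)"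
    from summable_on_SigmaD1[OF this] show
      "\<forall>t\<in>steps. (\<lambda>x. \<bar>f (x \<otimes> t) - f x\<bar> powr p) summable_on carrier G" by auto
  next
    assume *: "\<forall>t\<in>steps. (\<lambda>x. \<bar>f (x \<otimes> t) - f x\<bar> powr p) summable_on carrier G"
    show "(\<lambda>(t, x). \<bar>f (x \<otimes> t) - f x\<bar> powr p) summable_on (SIGMA t:steps. carrier G)"
      by (rule summable_on_SigmaI[where g = "\<lambda>t. \<Sum>\<^sub>\<infinity>x\<in>carrier G. \<bar>f (x \<otimes> t) - f x\<bar> powr p"])
         (use * in \<open>auto intro: has_sum_infsum\<close>)
  qed
  finally show ?thesis .
qed

text \<open>Finite energy controls the increments along every right translation, not only along the steps, since
  a translation by a word is a composition of steps. This makes the arguments about the semidirect product independent of the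
  generating set.\<close>
lemma Dp_translation_summable:
  assumes f: "f \<in> Dp (ereal p) G S" and p: "0 \<le> p" and y: "y \<in> carrier G"
  shows "(\<lambda>x. \<bar>f (x \<otimes> y) - f x\<bar> powr p) summable_on carrier G"
  using y
proof (induction rule: carrier_induct)
  case one
  show ?case by (rule summable_on_cong[THEN iffD1, OF _ summable_on_0[of _ "\<lambda>_. 0"]]) auto
next
  case (step y t)
  have "(\<lambda>x. \<bar>f (x \<otimes> t) - f x\<bar> powr p) summable_on carrier G"
    using f step by (simp add: Dp_iff)
  then have "(\<lambda>x. \<bar>f (x \<otimes> y \<otimes> t) - f (x \<otimes> y)\<bar> powr p) summable_on carrier G"
    using summable_right_translation[OF step(1), of "\<lambda>x. \<bar>f (x \<otimes> t) - f x\<bar> powr p"] by simp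
  from summable_on_cmult_right[OF summable_on_add[OF this step(3)], of "2 powr p"]
  show ?case
  proof (rule nonneg_summable_on_leI)
    fix x assume x: "x \<in> carrier G"
    show "\<bar>f (x \<otimes> (y \<otimes> t)) - f x\<bar> powr p
        \<le> 2 powr p * (\<bar>f (x \<otimes> y \<otimes> t) - f (x \<otimes> y)\<bar> powr p + \<bar>f (x \<otimes> y) - f x\<bar> powr p)"
      using powr_add_le[OF p, of "f (x \<otimes> y \<otimes> t) - f (x \<otimes> y)" "f (x \<otimes> y) - f x"] x step
      by (simp add: m_assoc)
  qed simp
qed

text \<open>The maximum principle: a finite superlevel set contains a global maximum, and by the mean value property
  the maximum spreads to all neighbours.\<close>
lemma harmonic_level_set_finite:
  assumes f: "f \<in> harmonic G S" and x: "x \<in> carrier G"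
    and fin: "finite {y \<in> carrier G. f y \<ge> f x}"
  shows "f constant_on carrier G"
proof -
  define X where "X = {y \<in> carrier G. f y \<ge> f x}"
  have X: "finite X" "X \<noteq> {}" using fin x by (auto simp: X_def)
  obtain m where m: "m \<in> X" "f m = Max (f ` X)"
    using Max_in[of "f ` X"] X by fastforce
  have mc: "m \<in> carrier G" using m by (simp add: X_def)
  have le: "f y \<le> f m" if "y \<in> carrier G" for y
  proof (cases "y \<in> X")
    case True
    then show ?thesis using m X by simp
  next
    case False
    then show ?thesis using that m(1) by (auto simp: X_def)
  qed
  have "f (m \<otimes> y) = f m" if "y \<in> carrier G" for y
    using that
  proof (induction rule: carrier_induct)
    case one
    then show ?case using mc by simp
  next
    case (step y t)
    have "(\<Sum>t\<in>steps. f m - f (m \<otimes> y \<otimes> t)) = 0"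
      using f[unfolded harmonic_iff, rule_format, of "m \<otimes> y"] step mc
      by (simp add: sum_subtractf)
    then have "f m - f (m \<otimes> y \<otimes> t) = 0"
      using sum_nonneg_eq_0_iff[of steps "\<lambda>t. f m - f (m \<otimes> y \<otimes> t)"] le mc step by simp
    then show ?case using mc step by (simp add: m_assoc)
  qed
  then have "f (m \<otimes> (inv m \<otimes> y)) = f m" if "y \<in> carrier G" for y
    using that mc by blast
  moreover have "m \<otimes> (inv m \<otimes> y) = y" if "y \<in> carrier G" for y
    using that mc by (simp add: m_assoc[symmetric])
  ultimately have "f y = f m" if "y \<in> carrier G" for y
    using that by simp
  then show ?thesis by (auto simp: constant_on_def)
qed

lemma harmonic_uminus: "f \<in> harmonic G S \<Longrightarrow> (\<lambda>x. - f x) \<in> harmonic G S"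
  by (simp add: harmonic_iff sum_negf)

lemma harmonic_vanishing_at_infinity:
  assumes f: "f \<in> harmonic G S"
    and fin: "\<And>e. e > 0 \<Longrightarrow> finite {x \<in> carrier G. \<bar>f x - a\<bar> \<ge> e}"
  shows "f constant_on carrier G"
proof (cases "\<forall>x\<in>carrier G. f x = a")
  case True
  then show ?thesis by (auto simp: constant_on_def)
next
  case False
  then obtain x where x: "x \<in> carrier G" "f x \<noteq> a" by auto
  show ?thesis
  proof (cases "f x > a")
    case True
    have "finite {y \<in> carrier G. f y \<ge> f x}"
      by (rule finite_subset[OF _ fin[of "f x - a"]]) (use True in auto)
    then show ?thesis using harmonic_level_set_finite f x by blast
  next
    case False
    have "finite {y \<in> carrier G. - f y \<ge> - f x}"
      by (rule finite_subset[OF _ fin[of "a - f x"]]) (use False x in auto)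
    then have "(\<lambda>x. - f x) constant_on carrier G"
      using harmonic_level_set_finite[OF harmonic_uminus[OF f]] x by blast
    then show ?thesis by (auto simp: constant_on_def) (metis minus_minus)
  qed
qed

end

section \<open>Balls and finitely supported functions\<close>

locale infinite_fg_group = fg_group +
  assumes infinite_carrier: "infinite (carrier G)"
begin

lemma steps_nonempty: "steps \<noteq> {}"
proof
  assume e: "steps = {}"
  have "x = \<one>" if "x \<in> carrier G" for x
    using that by (induction rule: carrier_induct) (auto simp: e)
  then have "carrier G \<subseteq> {\<one>}" by auto
  then show False using infinite_carrier finite_subset by blast
qed

definition valency :: real where "valency = real (card steps)"

lemma valency_pos [simp]: "valency > 0"
  using steps_nonempty by (simp add: card_gt_0_iff valency_def)

lemma valency_nonzero [simp]: "valency \<noteq> 0"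
  using valency_pos by linarith

lemma valency_nonneg [simp]: "0 \<le> valency"
  by (simp add: valency_def)

lemma card_steps [simp]: "real (card steps) = valency"
  by (simp add: valency_def)

abbreviation ball_of :: "nat \<Rightarrow> 'a set" where "ball_of n \<equiv> cayley_ball G S n"

lemma ball_0 [simp]: "ball_of 0 = {\<one>}"
  by (auto simp: cayley_ball_def)

lemma ball_Suc: "x \<in> ball_of (Suc n) \<longleftrightarrow> x \<in> ball_of n \<or> (\<exists>y\<in>ball_of n. \<exists>t\<in>steps. x = y \<otimes> t)"
proof
  assume "x \<in> ball_of (Suc n)"
  then obtain k where k: "k \<le> Suc n" "(\<one>, x) \<in> cayley_edges G S ^^ k"
    by (auto simp: cayley_ball_def)
  show "x \<in> ball_of n \<or> (\<exists>y\<in>ball_of n. \<exists>t\<in>steps. x = y \<otimes> t)"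
  proof (cases "k \<le> n")
    case True
    then show ?thesis using k by (auto simp: cayley_ball_def)
  next
    case False
    then have "k = Suc n" using k by simp
    then obtain y where "(\<one>, y) \<in> cayley_edges G S ^^ n" "(y, x) \<in> cayley_edges G S"
      using k by auto
    then show ?thesis by (auto simp: cayley_ball_def edge_iff)
  qed
next
  have car: "y \<in> carrier G" if "(\<one>, y) \<in> cayley_edges G S ^^ k" for y k
    using that by (cases k) (auto simp: edge_iff)
  assume "x \<in> ball_of n \<or> (\<exists>y\<in>ball_of n. \<exists>t\<in>steps. x = y \<otimes> t)"
  then show "x \<in> ball_of (Suc n)"
  proof
    assume "x \<in> ball_of n"
    then show ?thesis unfolding cayley_ball_def by (auto intro: le_SucI)
  next
    assume "\<exists>y\<in>ball_of n. \<exists>t\<in>steps. x = y \<otimes> t"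
    then obtain y t k where y: "k \<le> n" "(\<one>, y) \<in> cayley_edges G S ^^ k" "t \<in> steps" "x = y \<otimes> t"
      by (auto simp: cayley_ball_def)
    then have "(y, x) \<in> cayley_edges G S" using car by (auto simp: edge_iff)
    then have "(\<one>, x) \<in> cayley_edges G S ^^ Suc k" using y by auto
    then show ?thesis using y(1) unfolding cayley_ball_def by blast
  qed
qed

lemma ball_closed [simp]: "x \<in> ball_of n \<Longrightarrow> x \<in> carrier G"
  by (induction n arbitrary: x) (auto simp only: ball_0 ball_Suc singleton_iff one_closed m_closed steps_closed)

lemma ball_carrier: "ball_of n \<subseteq> carrier G"
  using ball_closed by blast

lemma one_in_ball [simp]: "\<one> \<in> ball_of n"
  by (induction n) (auto simp: ball_Suc)

lemma finite_ball [simp]: "finite (ball_of n)"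
proof (induction n)
  case (Suc n)
  have "ball_of (Suc n) = ball_of n \<union> (\<lambda>(y, t). y \<otimes> t) ` (ball_of n \<times> steps)"
    using ball_Suc by (auto simp: image_iff)
  then show ?case using Suc by simp
qed simp

lemma card_ball_pos: "card (ball_of n) > 0"
  using one_in_ball[of n] finite_ball[of n] card_gt_0_iff by blast

text \<open>The distributions of the walk are finitely supported. Working with sums over the whole group instead of
  sums over balls makes these sums invariant under translations.\<close>
definition fin_supp :: "('a \<Rightarrow> real) \<Rightarrow> bool" where
  "fin_supp f \<longleftrightarrow> finite {x \<in> carrier G. f x \<noteq> 0}"

abbreviation total :: "('a \<Rightarrow> real) \<Rightarrow> real" where
  "total f \<equiv> infsum f (carrier G)"

lemma fin_supp_summable: "fin_supp f \<Longrightarrow> f summable_on carrier G"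
  by (rule finite_nonzero_values_imp_summable_on) (simp add: fin_supp_def)

lemma fin_supp_mono:
  "fin_supp f \<Longrightarrow> (\<And>x. x \<in> carrier G \<Longrightarrow> f x = 0 \<Longrightarrow> h x = 0) \<Longrightarrow> fin_supp h"
  unfolding fin_supp_def by (erule finite_subset[rotated]) auto

lemma fin_supp_mult_left: "fin_supp f \<Longrightarrow> fin_supp (\<lambda>x. f x * h x)"
  by (erule fin_supp_mono) simp

lemma fin_supp_mult_right: "fin_supp f \<Longrightarrow> fin_supp (\<lambda>x. h x * f x)"
  by (erule fin_supp_mono) simp

lemma fin_supp_add: "fin_supp f \<Longrightarrow> fin_supp h \<Longrightarrow> fin_supp (\<lambda>x. f x + h x)"
  unfolding fin_supp_def
  by (rule finite_subset[of _ "{x \<in> carrier G. f x \<noteq> 0} \<union> {x \<in> carrier G. h x \<noteq> 0}"]) auto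

lemma fin_supp_diff: "fin_supp f \<Longrightarrow> fin_supp h \<Longrightarrow> fin_supp (\<lambda>x. f x - h x)"
  unfolding fin_supp_def
  by (rule finite_subset[of _ "{x \<in> carrier G. f x \<noteq> 0} \<union> {x \<in> carrier G. h x \<noteq> 0}"]) auto

lemma fin_supp_sum:
  "finite I \<Longrightarrow> (\<And>i. i \<in> I \<Longrightarrow> fin_supp (f i)) \<Longrightarrow> fin_supp (\<lambda>x. \<Sum>i\<in>I. f i x)"
  by (induction I rule: finite_induct) (auto simp: fin_supp_add, simp add: fin_supp_def)

lemma fin_supp_right_translation:
  assumes "y \<in> carrier G" "fin_supp f"
  shows "fin_supp (\<lambda>x. f (x \<otimes> y))"
proof -
  have "{x \<in> carrier G. f (x \<otimes> y) \<noteq> 0} \<subseteq> (\<lambda>x. x \<otimes> inv y) ` {x \<in> carrier G. f x \<noteq> 0}"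
  proof
    fix x assume "x \<in> {x \<in> carrier G. f (x \<otimes> y) \<noteq> 0}"
    then show "x \<in> (\<lambda>x. x \<otimes> inv y) ` {x \<in> carrier G. f x \<noteq> 0}"
      using assms(1) by (intro image_eqI[of _ _ "x \<otimes> y"]) (auto simp: m_assoc)
  qed
  then show ?thesis using assms(2) unfolding fin_supp_def
    by (rule finite_subset[OF _ finite_imageI])
qed

lemma fin_supp_left_translation:
  assumes "y \<in> carrier G" "fin_supp f"
  shows "fin_supp (\<lambda>x. f (y \<otimes> x))"
proof -
  have "{x \<in> carrier G. f (y \<otimes> x) \<noteq> 0} \<subseteq> (\<lambda>x. inv y \<otimes> x) ` {x \<in> carrier G. f x \<noteq> 0}"
  proof
    fix x assume "x \<in> {x \<in> carrier G. f (y \<otimes> x) \<noteq> 0}"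
    then show "x \<in> (\<lambda>x. inv y \<otimes> x) ` {x \<in> carrier G. f x \<noteq> 0}"
      using assms(1) by (intro image_eqI[of _ _ "y \<otimes> x"]) (auto simp: m_assoc[symmetric])
  qed
  then show ?thesis using assms(2) unfolding fin_supp_def
    by (rule finite_subset[OF _ finite_imageI])
qed

lemma total_add: "fin_supp f \<Longrightarrow> fin_supp h \<Longrightarrow> total (\<lambda>x. f x + h x) = total f + total h"
  by (intro infsum_add fin_supp_summable)

lemma total_diff: "fin_supp f \<Longrightarrow> fin_supp h \<Longrightarrow> total (\<lambda>x. f x - h x) = total f - total h"
  using infsum_add[of f "carrier G" "\<lambda>x. - h x"]
  by (simp add: fin_supp_summable summable_on_uminus infsum_uminus)

lemma total_sum:
  "finite I \<Longrightarrow> (\<And>i. i \<in> I \<Longrightarrow> fin_supp (f i)) \<Longrightarrow>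
    total (\<lambda>x. \<Sum>i\<in>I. f i x) = (\<Sum>i\<in>I. total (f i))"
  by (induction I rule: finite_induct) (auto simp: total_add fin_supp_sum)

lemma total_mono:
  "fin_supp f \<Longrightarrow> fin_supp h \<Longrightarrow> (\<And>x. x \<in> carrier G \<Longrightarrow> f x \<le> h x) \<Longrightarrow> total f \<le> total h"
  by (intro infsum_mono fin_supp_summable)

lemma total_eq_sum:
  assumes "finite X" "X \<subseteq> carrier G" "\<And>x. x \<in> carrier G \<Longrightarrow> f x \<noteq> 0 \<Longrightarrow> x \<in> X"
  shows "total f = sum f X"
proof -
  have "total f = infsum f X"
    by (rule infsum_cong_neutral) (use assms in auto)
  then show ?thesis using assms by simp
qed

section \<open>The lazy random walk\<close>

text \<open>The transition operator of the walk that stays put with probability \<open>1 / 2\<close> and otherwise makes a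
  uniform step. Laziness does not change the harmonic functions; it rules out periodicity, so that the
  energy dissipated by one application controls the full Dirichlet form (\<open>l2_lazy\<close>).\<close>
definition lazy :: "('a \<Rightarrow> real) \<Rightarrow> 'a \<Rightarrow> real" where
  "lazy g x = (\<Sum>t\<in>steps. g x + g (x \<otimes> t)) / (2 * valency)"

text \<open>The distribution after \<open>n\<close> steps from the neutral element. Because the steps are closed under
  inversion, the transition operator acts on distributions as it does on functions.\<close>
primrec walk :: "nat \<Rightarrow> 'a \<Rightarrow> real" where
  "walk 0 = (\<lambda>x. if x = \<one> then 1 else 0)"
| "walk (Suc n) = lazy (walk n)"

lemma lazy_fin_supp: "fin_supp f \<Longrightarrow> fin_supp (lazy f)"
  unfolding lazy_def divide_inverse
  by (intro fin_supp_mult_left fin_supp_sum fin_supp_add fin_supp_right_translation) auto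

lemma total_lazy:
  assumes "fin_supp f"
  shows "total (lazy f) = total f"
proof -
  have "total (lazy f) = total (\<lambda>x. \<Sum>t\<in>steps. f x + f (x \<otimes> t)) / (2 * valency)"
    unfolding lazy_def divide_inverse by (rule infsum_cmult_left')
  also have "total (\<lambda>x. \<Sum>t\<in>steps. f x + f (x \<otimes> t)) = (\<Sum>t\<in>steps. total f + total f)"
    using assms
    by (simp add: total_sum total_add fin_supp_add fin_supp_right_translation infsum_right_translation)
  also have "\<dots> / (2 * valency) = total f" using valency_pos by simp
  finally show ?thesis .
qed

text \<open>The set of steps is closed under inversion.\<close>
lemma lazy_self_adjoint:
  assumes "fin_supp f"
  shows "total (\<lambda>y. f y * lazy g y) = total (\<lambda>y. lazy f y * g y)"
proof -
  have tr: "total (\<lambda>y. f y * g (y \<otimes> t)) = total (\<lambda>y. f (y \<otimes> inv t) * g y)" if "t \<in> steps" for t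
  proof -
    have "total (\<lambda>y. f y * g (y \<otimes> t)) = total (\<lambda>y. f (y \<otimes> t \<otimes> inv t) * g (y \<otimes> t))"
      by (rule infsum_cong) (use that in \<open>simp add: m_assoc\<close>)
    also have "\<dots> = total (\<lambda>y. f (y \<otimes> inv t) * g y)"
      using infsum_right_translation[of t "\<lambda>y. f (y \<otimes> inv t) * g y"] that by simp
    finally show ?thesis .
  qed
  define c where "c = inverse (2 * valency)"
  have lz: "lazy h y = c * (\<Sum>t\<in>steps. h y + h (y \<otimes> t))" for h y
    unfolding lazy_def c_def divide_inverse by (rule mult.commute)
  have "total (\<lambda>y. f y * lazy g y) = total (\<lambda>y. c * (\<Sum>t\<in>steps. f y * g y + f y * g (y \<otimes> t)))"
    by (rule infsum_cong) (simp add: lz sum_distrib_left algebra_simps)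
  also have "\<dots> = c * (\<Sum>t\<in>steps. total (\<lambda>y. f y * g y) + total (\<lambda>y. f y * g (y \<otimes> t)))"
    using assms by (simp add: infsum_cmult_right' total_sum total_add fin_supp_add fin_supp_mult_left)
  also have "(\<Sum>t\<in>steps. total (\<lambda>y. f y * g y) + total (\<lambda>y. f y * g (y \<otimes> t)))
      = (\<Sum>t\<in>steps. total (\<lambda>y. f y * g y) + total (\<lambda>y. f (y \<otimes> inv t) * g y))"
    by (rule sum.cong) (auto simp: tr)
  also have "\<dots> = (\<Sum>t\<in>steps. total (\<lambda>y. f y * g y) + total (\<lambda>y. f (y \<otimes> t) * g y))"
    by (rule sum.reindex_bij_betw[OF bij_betw_inv_steps])
  also have "c * \<dots> = total (\<lambda>y. c * (\<Sum>t\<in>steps. f y * g y + f (y \<otimes> t) * g y))"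
  proof -
    have "fin_supp (\<lambda>y. f (y \<otimes> t) * g y)" if "t \<in> steps" for t
      using that assms by (intro fin_supp_mult_left fin_supp_right_translation) auto
    then show ?thesis
      using assms by (simp add: infsum_cmult_right' total_sum total_add fin_supp_add fin_supp_mult_left)
  qed
  also have "\<dots> = total (\<lambda>y. lazy f y * g y)"
    by (rule infsum_cong) (simp add: lz sum_distrib_left sum_distrib_right algebra_simps)
  finally show ?thesis .
qed

lemma walk_nonneg [simp]: "0 \<le> walk n x"
  by (induction n arbitrary: x) (auto simp: lazy_def intro!: divide_nonneg_nonneg sum_nonneg)

lemma walk_support: "x \<in> carrier G \<Longrightarrow> walk n x \<noteq> 0 \<Longrightarrow> x \<in> ball_of n"
proof (induction n arbitrary: x)
  case (Suc n)
  have "\<exists>t\<in>steps. walk n x + walk n (x \<otimes> t) \<noteq> 0"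
    using Suc.prems(2) by (force simp: lazy_def intro!: sum.neutral)
  then obtain t where t: "t \<in> steps" "walk n x \<noteq> 0 \<or> walk n (x \<otimes> t) \<noteq> 0" by auto
  from t(2) show ?case
  proof
    assume "walk n (x \<otimes> t) \<noteq> 0"
    then have "x \<otimes> t \<in> ball_of n" using Suc t by simp
    moreover have "x = (x \<otimes> t) \<otimes> inv t" using Suc.prems t by (simp add: m_assoc)
    moreover have "inv t \<in> steps" using t(1) by simp
    ultimately have "\<exists>y\<in>ball_of n. \<exists>s\<in>steps. x = y \<otimes> s" by blast
    then show ?thesis unfolding ball_Suc by blast
  qed (use Suc in \<open>auto simp: ball_Suc\<close>)
qed (simp split: if_splits)

lemma walk_fin_supp [simp]: "fin_supp (walk n)"
  unfolding fin_supp_def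
  by (rule finite_subset[OF _ finite_ball[of n]]) (auto intro: walk_support)

lemma total_walk_mult: "total (\<lambda>y. walk n y * h y) = (\<Sum>y\<in>ball_of n. walk n y * h y)"
  by (rule total_eq_sum) (auto intro: walk_support)

lemma total_walk [simp]: "total (walk n) = 1"
proof (induction n)
  case 0
  have "total (walk 0) = sum (walk 0) {\<one>}" by (rule total_eq_sum) (auto split: if_splits)
  then show ?case by simp
qed (simp add: total_lazy)

lemma sum_walk_ball: "(\<Sum>y\<in>ball_of n. walk n y) = 1"
  using total_walk_mult[of n "\<lambda>_. 1"] by simp

lemma lazy_power_eq_walk_average:
  "x \<in> carrier G \<Longrightarrow> (lazy ^^ n) g x = total (\<lambda>y. walk n y * g (x \<otimes> y))"
proof (induction n arbitrary: g)
  case 0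
  have "total (\<lambda>y. walk 0 y * g (x \<otimes> y)) = (\<Sum>y\<in>{\<one>}. walk 0 y * g (x \<otimes> y))"
    by (rule total_eq_sum) (auto split: if_splits)
  then show ?case using 0 by simp
next
  case (Suc n)
  have "(lazy ^^ Suc n) g x = total (\<lambda>y. walk n y * lazy g (x \<otimes> y))"
    using Suc by (simp only: funpow_Suc_right comp_def)
  also have "\<dots> = total (\<lambda>y. walk n y * lazy (\<lambda>y. g (x \<otimes> y)) y)"
    by (rule infsum_cong) (use Suc.prems in \<open>simp add: lazy_def m_assoc\<close>)
  also have "\<dots> = total (\<lambda>y. walk (Suc n) y * g (x \<otimes> y))"
    by (simp add: lazy_self_adjoint)
  finally show ?case .
qed

text \<open>The Chapman-Kolmogorov equation: by \<open>lazy_power_eq_walk_average\<close> the left-hand side is a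
  convolution.\<close>
lemma lazy_power_walk: "(lazy ^^ m) (walk n) = walk (m + n)"
  by (induction m) auto

section \<open>The Nash inequality and decay of the transition probabilities\<close>

definition l2 :: "('a \<Rightarrow> real) \<Rightarrow> real" where "l2 f = total (\<lambda>x. (f x)\<^sup>2)"

definition shift_energy :: "('a \<Rightarrow> real) \<Rightarrow> 'a \<Rightarrow> real" where
  "shift_energy f y = l2 (\<lambda>x. f (x \<otimes> y) - f x)"

lemma fin_supp_square: "fin_supp f \<Longrightarrow> fin_supp (\<lambda>x. (f x)\<^sup>2)"
  by (erule fin_supp_mono) simp

lemma l2_nonneg [simp]: "0 \<le> l2 f"
  by (simp add: l2_def infsum_nonneg)

lemma shift_energy_nonneg [simp]: "0 \<le> shift_energy f y"
  by (simp add: shift_energy_def)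

lemma l2_right_translation: "y \<in> carrier G \<Longrightarrow> l2 (\<lambda>x. f (x \<otimes> y)) = l2 f"
  unfolding l2_def by (rule infsum_right_translation)

text \<open>By convexity of the square on each step, where the defect in \<open>((a + b) / 2)\<^sup>2 \<le> (a\<^sup>2 + b\<^sup>2) / 2\<close>
  is exactly \<open>(a - b)\<^sup>2 / 4\<close>.\<close>
lemma l2_lazy:
  assumes f: "fin_supp f"
  shows "l2 (lazy f) \<le> l2 f - (\<Sum>t\<in>steps. shift_energy f t) / (4 * valency)"
proof -
  note fs = f fin_supp_square fin_supp_add fin_supp_diff fin_supp_right_translation[OF steps_closed]
    fin_supp_mult_right fin_supp_sum
  have pt: "(lazy f x)\<^sup>2 \<le> inverse valency *
      (\<Sum>t\<in>steps. (1 / 2) * ((f x)\<^sup>2 + (f (x \<otimes> t))\<^sup>2) - (1 / 4) * (f (x \<otimes> t) - f x)\<^sup>2)" for x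
  proof -
    have "(lazy f x)\<^sup>2 = (inverse valency)\<^sup>2 * (\<Sum>t\<in>steps. (f x + f (x \<otimes> t)) / 2)\<^sup>2"
      unfolding sum_divide_distrib[symmetric] lazy_def
      by (simp add: power_divide power_mult_distrib field_simps)
    also have "\<dots> \<le> (inverse valency)\<^sup>2 * ((\<Sum>t\<in>steps. ((f x + f (x \<otimes> t)) / 2)\<^sup>2) * valency)"
      unfolding valency_def by (intro mult_left_mono sum_squared_le_sum_of_squares) auto
    also have "\<dots> = inverse valency * (\<Sum>t\<in>steps. ((f x + f (x \<otimes> t)) / 2)\<^sup>2)"
      using valency_pos by (simp add: power2_eq_square)
    also have "(\<lambda>t. ((f x + f (x \<otimes> t)) / 2)\<^sup>2) =
        (\<lambda>t. (1 / 2) * ((f x)\<^sup>2 + (f (x \<otimes> t))\<^sup>2) - (1 / 4) * (f (x \<otimes> t) - f x)\<^sup>2)"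
      by (rule ext) (simp add: power2_eq_square field_simps)
    finally show ?thesis .
  qed
  have "l2 (lazy f) \<le> total (\<lambda>x. inverse valency *
      (\<Sum>t\<in>steps. (1 / 2) * ((f x)\<^sup>2 + (f (x \<otimes> t))\<^sup>2) - (1 / 4) * (f (x \<otimes> t) - f x)\<^sup>2))"
    unfolding l2_def
    by (rule total_mono) (intro fin_supp_square lazy_fin_supp fs finite_steps pt | assumption)+
  also have "\<dots> = inverse valency *
      (\<Sum>t\<in>steps. (1 / 2) * (l2 f + l2 (\<lambda>x. f (x \<otimes> t))) - (1 / 4) * shift_energy f t)"
    unfolding l2_def shift_energy_def
    by (simp del: times_divide_eq_left add: infsum_cmult_right' total_sum total_diff total_add fs)
  also have "\<dots> = inverse valency * (\<Sum>t\<in>steps. l2 f - (1 / 4) * shift_energy f t)"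
    by (simp add: l2_right_translation)
  also have "\<dots> = l2 f - (\<Sum>t\<in>steps. shift_energy f t) / (4 * valency)"
    by (simp del: times_divide_eq_left add: sum_subtractf sum_distrib_left[symmetric] right_diff_distrib)
       (simp add: inverse_eq_divide)
  finally show ?thesis .
qed

text \<open>The displacement in \<open>l2\<close>-norm under a word is at most the sum of the displacements under its letters.
  The induction uses squares, splitting \<open>(p + q)\<^sup>2\<close> with weights \<open>1 + r\<close> and \<open>1 + 1 / r\<close> so that
  \<open>r\<^sup>2\<close> becomes \<open>(r + 1)\<^sup>2\<close>.\<close>
lemma shift_energy_ball:
  assumes f: "fin_supp f"
  shows "y \<in> ball_of r \<Longrightarrow> shift_energy f y \<le> real r ^ 2 * (\<Sum>t\<in>steps. shift_energy f t)"
proof (induction r arbitrary: y)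
  case 0
  have "total (\<lambda>x. (f (x \<otimes> \<one>) - f x)\<^sup>2) = total (\<lambda>x. 0)" by (rule infsum_cong) simp
  then show ?case using 0 by (simp add: shift_energy_def l2_def)
next
  case (Suc r)
  define M where "M = (\<Sum>t\<in>steps. shift_energy f t)"
  have M: "M \<ge> 0" "shift_energy f t \<le> M" if "t \<in> steps" for t
    using that by (auto simp: M_def intro!: sum_nonneg member_le_sum)
  have M0: "M \<ge> 0" by (auto simp: M_def intro!: sum_nonneg)
  note fs = f fin_supp_square fin_supp_add fin_supp_diff fin_supp_right_translation
    fin_supp_mult_right
  consider "y \<in> ball_of r" | z t where "z \<in> ball_of r" "t \<in> steps" "y = z \<otimes> t"
    using Suc.prems by (auto simp: ball_Suc)
  then show ?case
  proof cases
    case 1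
    have "real r ^ 2 * M \<le> real (Suc r) ^ 2 * M"
      using M0 by (intro mult_right_mono power_mono) auto
    then show ?thesis using Suc.IH[OF 1] by (simp add: M_def)
  next
    case 2
    note zt = \<open>z \<in> ball_of r\<close> \<open>t \<in> steps\<close>
    show ?thesis
    proof (cases "r = 0")
      case True
      then show ?thesis using 2 M(2)[OF 2(2)] by (simp add: M_def)
    next
      case False
      define a where "a = real r"
      have a: "a > 0" using False by (simp add: a_def)
      have sq: "(p + q)\<^sup>2 \<le> (1 + a) * p\<^sup>2 + (1 + inverse a) * q\<^sup>2" for p q :: real
      proof -
        have "0 \<le> inverse a * (a * p - q)\<^sup>2" using a by simp
        also have "\<dots> = a * p\<^sup>2 + inverse a * q\<^sup>2 - 2 * p * q"
          using a by (simp add: power2_eq_square field_simps)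
        finally show ?thesis by (simp add: power2_eq_square algebra_simps)
      qed
      have tr: "l2 (\<lambda>x. f (x \<otimes> z \<otimes> t) - f (x \<otimes> z)) = shift_energy f t"
        unfolding shift_energy_def
        using l2_right_translation[of z "\<lambda>x. f (x \<otimes> t) - f x"] zt by simp
      have "shift_energy f y \<le> total (\<lambda>x. (1 + a) * (f (x \<otimes> z \<otimes> t) - f (x \<otimes> z))\<^sup>2
          + (1 + inverse a) * (f (x \<otimes> z) - f x)\<^sup>2)"
        unfolding shift_energy_def l2_def
      proof (rule total_mono)
        fix x assume "x \<in> carrier G"
        then show "(f (x \<otimes> y) - f x)\<^sup>2 \<le> (1 + a) * (f (x \<otimes> z \<otimes> t) - f (x \<otimes> z))\<^sup>2
            + (1 + inverse a) * (f (x \<otimes> z) - f x)\<^sup>2"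
          using sq[of "f (x \<otimes> z \<otimes> t) - f (x \<otimes> z)" "f (x \<otimes> z) - f x"] zt 2(3)
          by (simp add: m_assoc)
      qed (use zt 2(3) in \<open>auto intro!: fs fs(5)[of z "\<lambda>x. f (x \<otimes> t)"]\<close>)
      also have "\<dots> = (1 + a) * l2 (\<lambda>x. f (x \<otimes> z \<otimes> t) - f (x \<otimes> z)) + (1 + inverse a) * shift_energy f z"
        unfolding shift_energy_def l2_def using zt
        by (simp add: infsum_cmult_right' total_add fs fs(5)[of z "\<lambda>x. f (x \<otimes> t)"])
      also have "\<dots> \<le> (1 + a) * M + (1 + inverse a) * (a\<^sup>2 * M)"
        unfolding tr using a zt M(2) Suc.IH[of z]
        by (intro add_mono mult_left_mono) (auto simp: M_def a_def)
      also have "\<dots> = (a + 1)\<^sup>2 * M"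
        using a by (simp add: power2_eq_square field_simps)
      finally show ?thesis by (simp add: a_def M_def add.commute)
    qed
  qed
qed

lemma sum_translate_le_total:
  assumes f: "f summable_on carrier G" "\<And>x. x \<in> carrier G \<Longrightarrow> 0 \<le> f x"
    and Y: "finite Y" "Y \<subseteq> carrier G" and x: "x \<in> carrier G"
  shows "(\<Sum>y\<in>Y. f (x \<otimes> y)) \<le> total f"
proof -
  have "(\<Sum>y\<in>Y. f (x \<otimes> y)) \<le> total (\<lambda>y. f (x \<otimes> y))"
    by (rule finite_sum_le_infsum) (use assms summable_left_translation[OF x, of f] in auto)
  then show ?thesis using x by (simp add: infsum_left_translation)
qed

text \<open>Compare \<open>f\<close> with its average over translates by the ball of radius \<open>r\<close>. The difference is controlled by the
  energy; the average itself is at most \<open>1 / card (ball_of r)\<close> everywhere and has total mass one, so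
  its \<open>l2\<close> is at most \<open>1 / card (ball_of r)\<close>.\<close>
lemma nash_inequality:
  assumes f: "fin_supp f" "\<And>x. 0 \<le> f x" "total f = 1"
  shows "l2 f \<le> 2 * real r ^ 2 * (\<Sum>t\<in>steps. shift_energy f t) + 2 / real (card (ball_of r))"
proof -
  define N where "N = real (card (ball_of r))"
  have N: "N > 0" using card_ball_pos[of r] by (simp add: N_def)
  have cN: "real (card (ball_of r)) = N" by (simp add: N_def)
  define a where "a = (\<lambda>x. inverse N * (\<Sum>y\<in>ball_of r. f (x \<otimes> y)))"
  note fs = f(1) fin_supp_square fin_supp_add fin_supp_diff fin_supp_right_translation[OF ball_closed]
    fin_supp_mult_right fin_supp_sum
  have pt: "(f x)\<^sup>2 \<le> 2 * inverse N * (\<Sum>y\<in>ball_of r. (f (x \<otimes> y) - f x)\<^sup>2) + 2 * inverse N * a x"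
    if x: "x \<in> carrier G" for x
  proof -
    have a01: "0 \<le> a x" "a x \<le> inverse N"
      using sum_translate_le_total[OF fin_supp_summable[OF f(1)], of "ball_of r" x] f(2,3) x N
      by (auto simp: a_def ball_carrier intro!: mult_nonneg_nonneg sum_nonneg)
    have "inverse N * (\<Sum>y\<in>ball_of r. f x - f (x \<otimes> y)) + a x = inverse N * (N * f x)"
      by (simp add: a_def sum_subtractf cN right_diff_distrib)
    also have "\<dots> = f x" using N by simp
    finally have "(f x)\<^sup>2 = (inverse N * (\<Sum>y\<in>ball_of r. f x - f (x \<otimes> y)) + a x)\<^sup>2"
      by simp
    also have "\<dots> \<le> 2 * (inverse N * (\<Sum>y\<in>ball_of r. f x - f (x \<otimes> y)))\<^sup>2 + 2 * (a x)\<^sup>2"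
      using sum_squares_bound[of "inverse N * (\<Sum>y\<in>ball_of r. f x - f (x \<otimes> y))" "a x"]
      by (simp add: power2_sum)
    also have "(inverse N * (\<Sum>y\<in>ball_of r. f x - f (x \<otimes> y)))\<^sup>2
        \<le> (inverse N)\<^sup>2 * ((\<Sum>y\<in>ball_of r. (f x - f (x \<otimes> y))\<^sup>2) * N)"
      unfolding power_mult_distrib N_def
      by (intro mult_left_mono sum_squared_le_sum_of_squares) auto
    also have "\<dots> = inverse N * (\<Sum>y\<in>ball_of r. (f (x \<otimes> y) - f x)\<^sup>2)"
      unfolding power2_commute[of "f x"] using N by (simp add: power2_eq_square[of "inverse N"])
    also have "(a x)\<^sup>2 \<le> inverse N * a x"
      using a01 by (simp add: power2_eq_square mult_right_mono)
    finally show ?thesis by simp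
  qed
  have "l2 f \<le> total (\<lambda>x. 2 * inverse N * (\<Sum>y\<in>ball_of r. (f (x \<otimes> y) - f x)\<^sup>2) + 2 * inverse N * a x)"
    unfolding l2_def
    by (rule total_mono) (intro fs finite_ball pt | assumption | simp add: a_def)+
  also have "\<dots> = 2 * inverse N * (\<Sum>y\<in>ball_of r. shift_energy f y) + 2 * inverse N * total a"
    unfolding a_def shift_energy_def l2_def
    by (simp add: total_add total_sum infsum_cmult_right' fs)
  also have "total a = 1"
    unfolding a_def using f N
    by (simp add: total_sum infsum_cmult_right' fs infsum_right_translation cN)
  finally have le: "l2 f \<le> 2 * inverse N * (\<Sum>y\<in>ball_of r. shift_energy f y) + 2 * inverse N * 1" .
  have "(\<Sum>y\<in>ball_of r. shift_energy f y) \<le> N * (real r ^ 2 * (\<Sum>t\<in>steps. shift_energy f t))"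
    unfolding N_def by (intro sum_bounded_above shift_energy_ball f)
  then have "2 * inverse N * (\<Sum>y\<in>ball_of r. shift_energy f y)
      \<le> 2 * inverse N * (N * (real r ^ 2 * (\<Sum>t\<in>steps. shift_energy f t)))"
    using N by (intro mult_left_mono) auto
  also have "\<dots> = 2 * real r ^ 2 * (\<Sum>t\<in>steps. shift_energy f t)" using N by simp
  finally show ?thesis using le by (simp add: cN divide_inverse)
qed

lemma l2_walk_recursion:
  "l2 (walk n) \<le> 8 * valency * real r ^ 2 * (l2 (walk n) - l2 (walk (Suc n)))
    + 2 / real (card (ball_of r))"
proof -
  define E where "E = (\<Sum>t\<in>steps. shift_energy (walk n) t)"
  have "E \<le> 4 * valency * (l2 (walk n) - l2 (walk (Suc n)))"
    using l2_lazy[OF walk_fin_supp, of n] mult_left_mono[of "E / (4 * valency)" "l2 (walk n) - l2 (walk (Suc n))" "4 * valency"]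
    by (simp add: E_def)
  then have "2 * real r ^ 2 * E \<le> 2 * real r ^ 2 * (4 * valency * (l2 (walk n) - l2 (walk (Suc n))))"
    by (intro mult_left_mono) auto
  then show ?thesis using nash_inequality[of "walk n" r] by (simp add: E_def)
qed

lemma l2_walk_decreasing: "l2 (walk (Suc n)) \<le> l2 (walk n)"
proof -
  have "0 \<le> (\<Sum>t\<in>steps. shift_energy (walk n) t) / (4 * valency)"
    by (intro divide_nonneg_nonneg sum_nonneg) auto
  then show ?thesis using l2_lazy[OF walk_fin_supp, of n] by simp
qed

text \<open>Chapman-Kolmogorov, followed by \<open>x * y \<le> (x\<^sup>2 + y\<^sup>2) / 2\<close>.\<close>
lemma walk_le_l2:
  assumes "x \<in> carrier G"
  shows "walk (m + n) x \<le> (l2 (walk m) + l2 (walk n)) / 2"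
proof -
  define h :: real where "h = 1 / 2"
  have fs: "fin_supp (\<lambda>y. h * (walk m y)\<^sup>2)" "fin_supp (\<lambda>y. h * (walk n (x \<otimes> y))\<^sup>2)"
    "fin_supp (\<lambda>y. walk m y * walk n (x \<otimes> y))"
    by (intro fin_supp_mult_right fin_supp_square walk_fin_supp)
       (intro fin_supp_mult_right fin_supp_square fin_supp_left_translation[OF assms, of "walk n"] walk_fin_supp,
        rule fin_supp_mult_left[OF walk_fin_supp])
  have "walk (m + n) x = total (\<lambda>y. walk m y * walk n (x \<otimes> y))"
    using lazy_power_eq_walk_average[OF assms, of m "walk n"] by (simp add: lazy_power_walk)
  also have "\<dots> \<le> total (\<lambda>y. h * (walk m y)\<^sup>2 + h * (walk n (x \<otimes> y))\<^sup>2)"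
  proof (rule total_mono)
    fix y show "walk m y * walk n (x \<otimes> y) \<le> h * (walk m y)\<^sup>2 + h * (walk n (x \<otimes> y))\<^sup>2"
      using sum_squares_bound[of "walk m y" "walk n (x \<otimes> y)"] by (simp add: h_def)
  qed (intro fin_supp_add fs)+
  also have "\<dots> = h * l2 (walk m) + h * total (\<lambda>y. (walk n (x \<otimes> y))\<^sup>2)"
    unfolding l2_def by (simp add: total_add[OF fs(1,2)] infsum_cmult_right')
  also have "total (\<lambda>y. (walk n (x \<otimes> y))\<^sup>2) = l2 (walk n)"
    unfolding l2_def by (rule infsum_left_translation[OF assms])
  finally show ?thesis by (simp add: h_def)
qed

text \<open>A smaller constant makes the asymptotic bound valid for all positive radii, because balls are
  nonempty.\<close>
lemma growth_lower_bound:
  assumes "growth_at_least_degree G S d" "d \<ge> 0"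
  obtains c where "c > 0" "\<And>r. 1 \<le> r \<Longrightarrow> c * real r powr d \<le> real (card (ball_of r))"
proof -
  from assms(1) obtain c where c: "c > 0" "eventually (\<lambda>n. norm (growth G S n) \<ge> c * norm (real n powr d)) at_top"
    unfolding growth_at_least_degree_def by (elim landau_omega.bigE)
  then obtain N where N: "\<And>n. n \<ge> N \<Longrightarrow> growth G S n \<ge> c * real n powr d"
    by (auto simp: eventually_at_top_linorder growth_def)
  define c' where "c' = min c (real (max N 1) powr - d)"
  have "c' > 0" using c by (simp add: c'_def)
  moreover have "c' * real r powr d \<le> real (card (ball_of r))" if "1 \<le> r" for r
  proof (cases "r \<ge> N")
    case True
    have "c' * real r powr d \<le> c * real r powr d" by (intro mult_right_mono) (auto simp: c'_def)
    then show ?thesis using N[OF True] by (simp add: growth_def)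
  next
    case False
    have "c' * real r powr d \<le> real (max N 1) powr - d * real r powr d"
      by (intro mult_right_mono) (auto simp: c'_def)
    also have "\<dots> \<le> real (max N 1) powr - d * real (max N 1) powr d"
      using False assms(2) by (intro mult_left_mono powr_mono2) auto
    also have "\<dots> = 1" by (simp add: powr_minus)
    also have "\<dots> \<le> real (card (ball_of r))" using card_ball_pos[of r] by linarith
    finally show ?thesis .
  qed
  ultimately show ?thesis by (rule that)
qed

text \<open>Growth of degree \<open>d\<close> turns the Nash inequality into a recursion for \<open>l2 (walk n)\<close> with solution of order
  \<open>n powr - (d / 2)\<close>; half of the steps are spent on each factor of \<open>walk_le_l2\<close>. The shift to \<open>Suc n\<close>
  keeps the bound meaningful at \<open>n = 0\<close>.\<close>
lemma walk_decay:
  assumes g: "growth_at_least_degree G S d" and d: "d > 0"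
  obtains K where "K > 0" "\<And>n x. x \<in> carrier G \<Longrightarrow> walk n x \<le> K * real (Suc n) powr - (d / 2)"
proof -
  obtain c where c: "c > 0" "\<And>r. 1 \<le> r \<Longrightarrow> c * real r powr d \<le> real (card (ball_of r))"
    using growth_lower_bound[OF g] d by auto
  have "\<exists>K. \<forall>n\<ge>1. l2 (walk n) \<le> K * real n powr - (d / 2)"
  proof (rule polynomial_decay_of_nash_recursion[where A = "8 * valency" and B = "2 / c"])
    fix n r :: nat assume r: "1 \<le> r"
    have "2 / real (card (ball_of r)) \<le> 2 / (c * real r powr d)"
      using c r card_ball_pos[of r] by (intro divide_left_mono mult_pos_pos) auto
    also have "\<dots> = 2 / c * real r powr - d" by (simp add: powr_minus field_simps)
    finally show "l2 (walk n) \<le> 8 * valency * real r ^ 2 * (l2 (walk n) - l2 (walk (Suc n))) + 2 / c * real r powr - d"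
      using l2_walk_recursion[of n r] by simp
  qed (use c d l2_walk_decreasing in auto)
  then obtain K where K: "\<And>n. n \<ge> 1 \<Longrightarrow> l2 (walk n) \<le> K * real n powr - (d / 2)" by auto
  have mono: "l2 (walk n) \<le> l2 (walk m)" if "m \<le> n" for m n
    using lift_Suc_antimono_le[of "\<lambda>n. l2 (walk n)", OF _ that] l2_walk_decreasing by auto
  define K' where "K' = (max K 0 + l2 (walk 0) + 1) * 4 powr (d / 2)"
  have "walk n x \<le> K' * real (Suc n) powr - (d / 2)" if x: "x \<in> carrier G" for n x
  proof -
    define m where "m = n div 2"
    have "n \<le> 2 * m + 1" by (auto simp: m_def)
    then have nm': "real n \<le> 2 * real m + 1" by linarith
    have "walk n x \<le> (l2 (walk m) + l2 (walk (n - m))) / 2"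
      using walk_le_l2[OF x, of m "n - m"] by (simp add: m_def)
    also have "\<dots> \<le> l2 (walk m)" using mono[of m "n - m"] by (simp add: m_def)
    also have "\<dots> \<le> (max K 0 + l2 (walk 0) + 1) * (real (Suc n) / 4) powr - (d / 2)"
    proof (cases "m = 0")
      case True
      then have "real (Suc n) / 4 \<le> 1" using nm' by simp
      then have "1 powr - (d/2) \<le> (real (Suc n) / 4) powr - (d / 2)"
        using d by (intro powr_mono2') auto
      then have "(max K 0 + l2 (walk 0) + 1) * 1 \<le> (max K 0 + l2 (walk 0) + 1) * (real (Suc n) / 4) powr - (d / 2)"
        by (intro mult_left_mono) auto
      then show ?thesis using True by simp
    next
      case False
      have "1 \<le> m" using False by simp
      then have "real (Suc n) / 4 \<le> real m" using nm' by simp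
      then have "real m powr - (d / 2) \<le> (real (Suc n) / 4) powr - (d / 2)"
        using d by (intro powr_mono2') auto
      moreover have "K \<le> max K 0 + l2 (walk 0) + 1" using l2_nonneg[of "walk 0"] by linarith
      ultimately have "K * real m powr - (d / 2) \<le> (max K 0 + l2 (walk 0) + 1) * (real (Suc n) / 4) powr - (d / 2)"
        using l2_nonneg[of "walk 0"] by (intro mult_mono) (auto simp del: walk.simps)
      then show ?thesis using K[of m] False by simp
    qed
    also have "\<dots> = K' * real (Suc n) powr - (d / 2)"
      unfolding K'_def by (subst powr_divide) (auto simp: powr_minus field_simps)
    finally show ?thesis .
  qed
  moreover have "max K 0 + l2 (walk 0) + 1 > 0" using l2_nonneg[of "walk 0"] by linarith
  then have "K' > 0" unfolding K'_def by (intro mult_pos_pos) auto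
  ultimately show ?thesis using that by blast
qed

section \<open>The boundary extension of a function of finite energy\<close>

text \<open>The \<open>p\<close>-th power of the \<open>\<ell>\<^sup>p\<close>-norm of the gradient.\<close>
definition energy :: "real \<Rightarrow> ('a \<Rightarrow> real) \<Rightarrow> real" where
  "energy p g = (\<Sum>t\<in>steps. total (\<lambda>x. \<bar>g (x \<otimes> t) - g x\<bar> powr p))"

lemma energy_nonneg [simp]: "0 \<le> energy p g"
  by (auto simp: energy_def intro!: sum_nonneg infsum_nonneg)

definition drift :: "('a \<Rightarrow> real) \<Rightarrow> 'a \<Rightarrow> real" where
  "drift g x = lazy g x - g x"

lemma lazy_eq_iff: "lazy f x = c \<longleftrightarrow> valency * f x + (\<Sum>t\<in>steps. f (x \<otimes> t)) = 2 * valency * c"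
  by (auto simp: lazy_def sum.distrib field_simps)

lemma harmonic_iff_lazy: "f \<in> harmonic G S \<longleftrightarrow> (\<forall>x\<in>carrier G. lazy f x = f x)"
proof -
  have "lazy f x = f x \<longleftrightarrow> valency * f x = (\<Sum>t\<in>steps. f (x \<otimes> t))" for x
    unfolding lazy_eq_iff by (intro iffI) linarith+
  then show ?thesis by (simp add: harmonic_iff)
qed

lemma lazy_diff: "lazy (\<lambda>x. f x - h x) = (\<lambda>x. lazy f x - lazy h x)"
proof
  fix x
  have "(\<Sum>t\<in>steps. (f x - h x) + (f (x \<otimes> t) - h (x \<otimes> t)))
      = (\<Sum>t\<in>steps. f x + f (x \<otimes> t)) - (\<Sum>t\<in>steps. h x + h (x \<otimes> t))"
    unfolding sum_subtractf[symmetric] by (rule sum.cong) auto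
  then show "lazy (\<lambda>x. f x - h x) x = lazy f x - lazy h x"
    by (simp only: lazy_def diff_divide_distrib)
qed

lemma lazy_power_drift: "(lazy ^^ n) (drift g) = (\<lambda>x. (lazy ^^ Suc n) g x - (lazy ^^ n) g x)"
proof (induction n)
  case 0
  show ?case by (rule ext) (simp add: drift_def)
next
  case (Suc n)
  have "(lazy ^^ Suc n) (drift g) = lazy ((lazy ^^ n) (drift g))" by simp
  then show ?case unfolding Suc.IH lazy_diff by simp
qed

lemma drift_powr_sum:
  assumes p: "1 \<le> p" and g: "g \<in> Dp (ereal p) G S"
  shows "(\<lambda>x. \<bar>drift g x\<bar> powr p) summable_on carrier G"
    and "total (\<lambda>x. \<bar>drift g x\<bar> powr p) \<le> energy p g"
proof -
  have hs: "((\<lambda>x. \<Sum>t\<in>steps. \<bar>g (x \<otimes> t) - g x\<bar> powr p) has_sum energy p g) (carrier G)"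
    unfolding energy_def using g by (intro has_sum_finite_sum) (auto simp: Dp_iff)
  have "card steps \<ge> 1" using steps_nonempty by (simp add: Suc_le_eq card_gt_0_iff)
  then have v1: "valency \<ge> 1" by (simp add: valency_def del: card_steps)
  have pt: "\<bar>drift g x\<bar> powr p \<le> (\<Sum>t\<in>steps. \<bar>g (x \<otimes> t) - g x\<bar> powr p)" for x
  proof -
    have "(\<Sum>t\<in>steps. g (x \<otimes> t) - g x) = 2 * valency * drift g x"
      using lazy_eq_iff[of g x "lazy g x"] by (simp add: drift_def sum_subtractf algebra_simps)
    then have "drift g x = 1 / (2 * valency) * (\<Sum>t\<in>steps. g (x \<otimes> t) - g x)" by simp
    also have "\<dots> = (\<Sum>t\<in>steps. 1 / (2 * valency) * (g (x \<otimes> t) - g x))"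
      by (rule sum_distrib_left)
    finally have dr: "drift g x = (\<Sum>t\<in>steps. 1 / (2 * valency) * (g (x \<otimes> t) - g x))" .
    have "\<bar>drift g x\<bar> powr p \<le> 1 powr (p - 1) * (\<Sum>t\<in>steps. 1 / (2 * valency) * \<bar>g (x \<otimes> t) - g x\<bar> powr p)"
      unfolding dr by (rule powr_sum_le[OF p]) auto
    also have "\<dots> = (\<Sum>t\<in>steps. 1 / (2 * valency) * \<bar>g (x \<otimes> t) - g x\<bar> powr p)" by simp
    also have "\<dots> \<le> (\<Sum>t\<in>steps. 1 * \<bar>g (x \<otimes> t) - g x\<bar> powr p)"
      using v1 by (intro sum_mono mult_right_mono) auto
    finally show ?thesis by simp
  qed
  show s: "(\<lambda>x. \<bar>drift g x\<bar> powr p) summable_on carrier G"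
    by (rule nonneg_summable_on_leI[OF has_sum_imp_summable[OF hs]]) (auto intro: pt)
  show "total (\<lambda>x. \<bar>drift g x\<bar> powr p) \<le> energy p g"
    by (rule has_sum_mono[OF has_sum_infsum[OF s] hs]) (rule pt)
qed

lemma lazy_power_eq_sum:
  "x \<in> carrier G \<Longrightarrow> (lazy ^^ n) h x = (\<Sum>y\<in>ball_of n. walk n y * h (x \<otimes> y))"
  by (simp add: lazy_power_eq_walk_average total_walk_mult)

lemma lazy_power_powr_le:
  assumes p: "1 \<le> p" and x: "x \<in> carrier G"
  shows "\<bar>(lazy ^^ n) h x\<bar> powr p \<le> (\<Sum>y\<in>ball_of n. walk n y * \<bar>h (x \<otimes> y)\<bar> powr p)"
  using powr_sum_le[OF p, of "ball_of n" "walk n" 1 "\<lambda>y. h (x \<otimes> y)"]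
  by (simp add: lazy_power_eq_sum[OF x] sum_walk_ball)

text \<open>An average over the walk of a function in \<open>\<ell>\<^sup>p\<close> is pointwise small, as the mass is spread
  thin.\<close>
lemma lazy_power_sup_bound:
  assumes p: "1 \<le> p" and x: "x \<in> carrier G"
    and h: "(\<lambda>x. \<bar>h x\<bar> powr p) summable_on carrier G"
    and b: "\<And>y. y \<in> carrier G \<Longrightarrow> walk n y \<le> b"
  shows "\<bar>(lazy ^^ n) h x\<bar> powr p \<le> b * total (\<lambda>x. \<bar>h x\<bar> powr p)"
proof -
  have b0: "0 \<le> b" using order_trans[OF walk_nonneg b[OF one_closed]] .
  have "\<bar>(lazy ^^ n) h x\<bar> powr p \<le> (\<Sum>y\<in>ball_of n. b * \<bar>h (x \<otimes> y)\<bar> powr p)"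
    by (rule order_trans[OF lazy_power_powr_le[OF p x]]) (intro sum_mono mult_right_mono b, auto)
  also have "\<dots> = b * (\<Sum>y\<in>ball_of n. \<bar>h (x \<otimes> y)\<bar> powr p)" by (simp add: sum_distrib_left)
  also have "\<dots> \<le> b * total (\<lambda>x. \<bar>h x\<bar> powr p)"
    using sum_translate_le_total[OF h, of "ball_of n" x] x b0 ball_carrier by (intro mult_left_mono) auto
  finally show ?thesis .
qed

text \<open>Averaging is a contraction of \<open>\<ell>\<^sup>p\<close>.\<close>
lemma lazy_power_powr_sum_bound:
  assumes p: "1 \<le> p"
    and h: "(\<lambda>x. \<bar>h x\<bar> powr p) summable_on carrier G"
    and X: "finite X" "X \<subseteq> carrier G"
  shows "(\<Sum>x\<in>X. \<bar>(lazy ^^ n) h x\<bar> powr p) \<le> total (\<lambda>x. \<bar>h x\<bar> powr p)"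
proof -
  have le: "(\<Sum>x\<in>X. \<bar>h (x \<otimes> y)\<bar> powr p) \<le> total (\<lambda>x. \<bar>h x\<bar> powr p)" if y: "y \<in> carrier G" for y
  proof -
    have "(\<Sum>x\<in>X. \<bar>h (x \<otimes> y)\<bar> powr p) \<le> total (\<lambda>x. \<bar>h (x \<otimes> y)\<bar> powr p)"
      using summable_right_translation[OF y, of "\<lambda>x. \<bar>h x\<bar> powr p"] h X
      by (intro finite_sum_le_infsum) auto
    also have "\<dots> = total (\<lambda>x. \<bar>h x\<bar> powr p)"
      by (rule infsum_right_translation[OF y, of "\<lambda>x. \<bar>h x\<bar> powr p"])
    finally show ?thesis .
  qed
  have "(\<Sum>x\<in>X. \<bar>(lazy ^^ n) h x\<bar> powr p) \<le> (\<Sum>x\<in>X. \<Sum>y\<in>ball_of n. walk n y * \<bar>h (x \<otimes> y)\<bar> powr p)"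
    by (intro sum_mono lazy_power_powr_le p) (use X in auto)
  also have "\<dots> = (\<Sum>y\<in>ball_of n. walk n y * (\<Sum>x\<in>X. \<bar>h (x \<otimes> y)\<bar> powr p))"
    by (subst sum.swap) (simp add: sum_distrib_left)
  also have "\<dots> \<le> (\<Sum>y\<in>ball_of n. walk n y * total (\<lambda>x. \<bar>h x\<bar> powr p))"
    by (intro sum_mono mult_left_mono le) auto
  also have "\<dots> = total (\<lambda>x. \<bar>h x\<bar> powr p)"
    by (simp add: sum_distrib_right[symmetric] sum_walk_ball)
  finally show ?thesis .
qed

text \<open>\<open>(lazy ^^ n) (drift g)\<close> is the change of the \<open>n\<close>-step average of \<open>g\<close> when one more step is made.\<close>
lemma increment_decay:
  assumes p: "1 \<le> p" and gr: "growth_at_least_degree G S d" and d: "d > 0"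
  obtains K where "K \<ge> 0"
    "\<And>g n x. g \<in> Dp (ereal p) G S \<Longrightarrow> x \<in> carrier G \<Longrightarrow>
      \<bar>(lazy ^^ n) (drift g) x\<bar> \<le> K * real (Suc n) powr - (d / (2 * p)) * energy p g powr (1 / p)"
proof -
  obtain K where K: "K > 0" "\<And>n x. x \<in> carrier G \<Longrightarrow> walk n x \<le> K * real (Suc n) powr - (d / 2)"
    using walk_decay[OF gr d] by blast
  have "\<bar>(lazy ^^ n) (drift g) x\<bar> \<le> K powr (1 / p) * real (Suc n) powr - (d / (2 * p)) * energy p g powr (1 / p)"
    if g: "g \<in> Dp (ereal p) G S" and x: "x \<in> carrier G" for g n x
  proof -
    have "\<bar>(lazy ^^ n) (drift g) x\<bar> powr p
        \<le> K * real (Suc n) powr - (d / 2) * total (\<lambda>x. \<bar>drift g x\<bar> powr p)"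
      by (rule lazy_power_sup_bound[OF p x drift_powr_sum(1)[OF p g] K(2)])
    also have "\<dots> \<le> K * real (Suc n) powr - (d / 2) * energy p g"
      using K drift_powr_sum(2)[OF p g] by (intro mult_left_mono) auto
    finally have "(\<bar>(lazy ^^ n) (drift g) x\<bar> powr p) powr (1 / p)
        \<le> (K * real (Suc n) powr - (d / 2) * energy p g) powr (1 / p)"
      using p by (intro powr_mono2) auto
    also have "(\<bar>(lazy ^^ n) (drift g) x\<bar> powr p) powr (1 / p) = \<bar>(lazy ^^ n) (drift g) x\<bar>"
      using p by (simp add: powr_powr)
    also have "(K * real (Suc n) powr - (d / 2) * energy p g) powr (1 / p)
        = K powr (1 / p) * real (Suc n) powr - (d / (2 * p)) * energy p g powr (1 / p)"
      using K p by (simp add: powr_mult powr_powr mult.commute)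
    finally show ?thesis .
  qed
  then show ?thesis using that[of "K powr (1 / p)"] by simp
qed

text \<open>The discrete Poisson integral: the expected value of \<open>g\<close> at the end of the walk started at
  \<open>x\<close>.\<close>
definition boundary_extension :: "('a \<Rightarrow> real) \<Rightarrow> 'a \<Rightarrow> real" where
  "boundary_extension g x = lim (\<lambda>n. (lazy ^^ n) g x)"

lemma lazy_power_telescope:
  "(\<Sum>i<n. (lazy ^^ i) (drift g) x) = (lazy ^^ n) g x - g x"
  unfolding lazy_power_drift using sum_lessThan_telescope[of "\<lambda>n. (lazy ^^ n) g x" n] by simp

lemma summable_real_Suc_powr: "s < -1 \<Longrightarrow> summable (\<lambda>n. real (Suc n) powr s)"
  using summable_real_powr_iff[of s] summable_Suc_iff[of "\<lambda>n. real n powr s"] by simp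

context
  fixes p d :: real
  assumes p: "1 \<le> p" and gr: "growth_at_least_degree G S d" and d: "d > 2 * p"
begin

text \<open>The increments are summable uniformly in \<open>x\<close> because \<open>d / (2 * p) > 1\<close>. This gives convergence and the
  bound. Each single increment is in \<open>\<ell>\<^sup>p\<close>, hence tends to zero at infinity, and so does their uniformly
  convergent sum.\<close>
lemma boundary_extension_approx:
  "\<exists>K\<ge>0. \<forall>g\<in>Dp (ereal p) G S.
    (\<forall>x\<in>carrier G. (\<lambda>n. (lazy ^^ n) g x) \<longlonglongrightarrow> boundary_extension g x \<and>
      \<bar>boundary_extension g x - g x\<bar> \<le> K * energy p g powr (1 / p)) \<and>
    (\<forall>e>0. finite {x \<in> carrier G. \<bar>boundary_extension g x - g x\<bar> \<ge> e})"
proof -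
  obtain K where K: "K \<ge> 0" "\<And>g n x. g \<in> Dp (ereal p) G S \<Longrightarrow> x \<in> carrier G \<Longrightarrow>
      \<bar>(lazy ^^ n) (drift g) x\<bar> \<le> K * real (Suc n) powr - (d / (2 * p)) * energy p g powr (1 / p)"
    using increment_decay[OF p gr] p d by auto
  define a where "a = (\<lambda>n. K * real (Suc n) powr - (d / (2 * p)))"
  have a: "summable a" "\<And>n. a n \<ge> 0"
  proof -
    show "summable a" unfolding a_def using p d
      by (intro summable_mult summable_real_Suc_powr) (auto simp: field_simps)
  qed (use K(1) in \<open>simp add: a_def\<close>)
  have Fa: "\<bar>(lazy ^^ n) (drift g) x\<bar> \<le> a n * energy p g powr (1 / p)"
    if "g \<in> Dp (ereal p) G S" "x \<in> carrier G" for g n x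
    using K(2)[OF that] by (simp add: a_def)
  have sumF: "summable (\<lambda>n. \<bar>(lazy ^^ n) (drift g) x\<bar>)" "summable (\<lambda>n. (lazy ^^ n) (drift g) x)"
    if "g \<in> Dp (ereal p) G S" "x \<in> carrier G" for g x
  proof -
    show s: "summable (\<lambda>n. \<bar>(lazy ^^ n) (drift g) x\<bar>)"
      by (rule summable_rabs_comparison_test[of _ "\<lambda>n. a n * energy p g powr (1 / p)"])
         (use Fa[OF that] a in \<open>auto intro: summable_mult2\<close>)
    show "summable (\<lambda>n. (lazy ^^ n) (drift g) x)"
      using s by (rule summable_rabs_cancel)
  qed
  have lim: "(\<lambda>n. (lazy ^^ n) g x) \<longlonglongrightarrow> boundary_extension g x"
    and ext: "boundary_extension g x - g x = (\<Sum>n. (lazy ^^ n) (drift g) x)"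
    if g: "g \<in> Dp (ereal p) G S" and x: "x \<in> carrier G" for g x
  proof -
    have "(\<lambda>n. (lazy ^^ n) g x - g x) \<longlonglongrightarrow> (\<Sum>n. (lazy ^^ n) (drift g) x)"
      using summable_LIMSEQ[OF sumF(2)[OF g x]] by (simp only: lazy_power_telescope)
    from tendsto_add[OF this tendsto_const[of "g x"]]
    have *: "(\<lambda>n. (lazy ^^ n) g x) \<longlonglongrightarrow> (\<Sum>n. (lazy ^^ n) (drift g) x) + g x" by simp
    then have eq: "boundary_extension g x = (\<Sum>n. (lazy ^^ n) (drift g) x) + g x"
      unfolding boundary_extension_def by (rule limI)
    show "(\<lambda>n. (lazy ^^ n) g x) \<longlonglongrightarrow> boundary_extension g x" using * eq by simp
    show "boundary_extension g x - g x = (\<Sum>n. (lazy ^^ n) (drift g) x)" using eq by simp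
  qed
  have tail: "\<bar>\<Sum>n. (lazy ^^ (n + k)) (drift g) x\<bar> \<le> (\<Sum>n. a (n + k)) * energy p g powr (1 / p)"
    if g: "g \<in> Dp (ereal p) G S" and x: "x \<in> carrier G" for g x k
  proof -
    have s: "summable (\<lambda>n. \<bar>(lazy ^^ (n + k)) (drift g) x\<bar>)"
      using sumF(1)[OF g x] summable_iff_shift[of "\<lambda>n. \<bar>(lazy ^^ n) (drift g) x\<bar>" k] by simp
    have sa: "summable (\<lambda>n. a (n + k))" using a(1) summable_iff_shift by blast
    have "\<bar>\<Sum>n. (lazy ^^ (n + k)) (drift g) x\<bar> \<le> (\<Sum>n. \<bar>(lazy ^^ (n + k)) (drift g) x\<bar>)"
      by (rule summable_rabs[OF s])
    also have "\<dots> \<le> (\<Sum>n. a (n + k) * energy p g powr (1 / p))"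
      by (rule suminf_le[OF Fa[OF g x] s summable_mult2[OF sa]])
    also have "\<dots> = (\<Sum>n. a (n + k)) * energy p g powr (1 / p)"
      by (rule suminf_mult2[OF sa, symmetric])
    finally show ?thesis .
  qed
  show ?thesis
  proof (intro exI[of _ "suminf a"] conjI ballI allI impI)
    show "0 \<le> suminf a" using a by (simp add: suminf_nonneg)
  next
    fix g x assume g: "g \<in> Dp (ereal p) G S" and x: "x \<in> carrier G"
    show "(\<lambda>n. (lazy ^^ n) g x) \<longlonglongrightarrow> boundary_extension g x" by (rule lim[OF g x])
    show "\<bar>boundary_extension g x - g x\<bar> \<le> suminf a * energy p g powr (1 / p)"
      using ext[OF g x] tail[OF g x, of 0] by simp
  next
    fix g and e :: real assume g: "g \<in> Dp (ereal p) G S" and e: "e > 0"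
    define E where "E = energy p g powr (1 / p) + 1"
    have E: "E > 0" by (simp add: E_def add_nonneg_pos)
    obtain N where N: "\<And>n. n \<ge> N \<Longrightarrow> norm (\<Sum>i. a (i + n)) < e / (2 * E)"
      using suminf_exist_split[OF _ a(1), of "e / (2 * E)"] e E by auto
    define k where "k = Suc N"
    have k0: "real k > 0" by (simp add: k_def)
    have tl: "\<bar>\<Sum>n. (lazy ^^ (n + k)) (drift g) x\<bar> < e / 2" if x: "x \<in> carrier G" for x
    proof -
      have "\<bar>\<Sum>n. (lazy ^^ (n + k)) (drift g) x\<bar> \<le> (\<Sum>n. a (n + k)) * energy p g powr (1 / p)"
        by (rule tail[OF g x])
      also have "\<dots> \<le> norm (\<Sum>n. a (n + k)) * E"
        by (intro mult_mono) (auto simp: E_def)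
      also have "\<dots> < e / (2 * E) * E"
        using N[of k] E by (intro mult_strict_right_mono) (auto simp: k_def)
      also have "\<dots> = e / 2" using E by simp
      finally show ?thesis .
    qed
    have "{x \<in> carrier G. \<bar>boundary_extension g x - g x\<bar> \<ge> e}
      \<subseteq> (\<Union>n<k. {x \<in> carrier G. \<bar>(lazy ^^ n) (drift g) x\<bar> \<ge> e / (2 * real k)})"
    proof
      fix x assume "x \<in> {x \<in> carrier G. \<bar>boundary_extension g x - g x\<bar> \<ge> e}"
      then have x: "x \<in> carrier G" "\<bar>boundary_extension g x - g x\<bar> \<ge> e" by auto
      have "boundary_extension g x - g x = (\<Sum>n. (lazy ^^ (n + k)) (drift g) x) + (\<Sum>n<k. (lazy ^^ n) (drift g) x)"
        unfolding ext[OF g x(1)] by (rule suminf_split_initial_segment[OF sumF(2)[OF g x(1)]])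
      then have big: "\<bar>\<Sum>n<k. (lazy ^^ n) (drift g) x\<bar> > e / 2" using tl[OF x(1)] x(2) by linarith
      show "x \<in> (\<Union>n<k. {x \<in> carrier G. \<bar>(lazy ^^ n) (drift g) x\<bar> \<ge> e / (2 * real k)})"
      proof (rule ccontr)
        assume "\<not> ?thesis"
        then have "\<And>n. n < k \<Longrightarrow> \<bar>(lazy ^^ n) (drift g) x\<bar> \<le> e / (2 * real k)" using x(1) by force
        then have "(\<Sum>n<k. \<bar>(lazy ^^ n) (drift g) x\<bar>) \<le> (\<Sum>n<k. e / (2 * real k))"
          by (intro sum_mono) auto
        also have "\<dots> = e / 2" using k0 by simp
        finally show False using big sum_abs[of "\<lambda>n. (lazy ^^ n) (drift g) x" "{..<k}"] by linarith
      qed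
    qed
    moreover have "finite {x \<in> carrier G. \<bar>(lazy ^^ n) (drift g) x\<bar> \<ge> e / (2 * real k)}" for n
    proof (rule finite_level_set_of_powr_summable[where p = p])
      show "(\<lambda>x. \<bar>(lazy ^^ n) (drift g) x\<bar> powr p) summable_on carrier G"
        by (rule nonneg_bdd_above_summable_on)
           (auto intro!: bdd_aboveI[of _ "total (\<lambda>x. \<bar>drift g x\<bar> powr p)"]
             lazy_power_powr_sum_bound drift_powr_sum g p)
    qed (use e p in \<open>auto simp: k_def\<close>)
    ultimately show "finite {x \<in> carrier G. \<bar>boundary_extension g x - g x\<bar> \<ge> e}"
      by (auto intro: finite_subset)
  qed
qed

lemma boundary_extension_harmonic:
  assumes g: "g \<in> Dp (ereal p) G S"
  shows "boundary_extension g \<in> harmonic G S"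
  unfolding harmonic_iff_lazy
proof
  fix x assume x: "x \<in> carrier G"
  have lim: "(\<lambda>n. (lazy ^^ n) g y) \<longlonglongrightarrow> boundary_extension g y" if "y \<in> carrier G" for y
    using boundary_extension_approx g that by blast
  have "(\<lambda>n. lazy ((lazy ^^ n) g) x) \<longlonglongrightarrow> lazy (boundary_extension g) x"
    unfolding lazy_def[of _ x] by (intro tendsto_divide tendsto_sum tendsto_add tendsto_const lim x) (auto simp: x)
  moreover have "(\<lambda>n. lazy ((lazy ^^ n) g) x) \<longlonglongrightarrow> boundary_extension g x"
    using LIMSEQ_Suc[OF lim[OF x]] by simp
  ultimately show "lazy (boundary_extension g) x = boundary_extension g x"
    by (rule LIMSEQ_unique)
qed

text \<open>Interpolating between the sup-norm, where the increments decay at any polynomial rate, and \<open>\<ell>\<^sup>p\<close>,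
  where they stay bounded, one gets \<open>\<ell>\<^sup>q\<close>-norms with a summable bound for any \<open>q > p\<close>. The rate \<open>D\<close>
  is chosen such that the interpolated bound is of order \<open>n powr - 2\<close>.\<close>
lemma boundary_extension_q_summable:
  assumes g: "g \<in> Dp (ereal p) G S" and q: "p < q"
    and fast: "\<And>D. growth_at_least_degree G S D"
  shows "(\<lambda>x. \<bar>boundary_extension g x - g x\<bar> powr q) summable_on carrier G"
proof -
  define D where "D = 4 * p * q / (q - p)"
  have D: "D > 0" using p q by (auto simp: D_def)
  obtain K where K: "K \<ge> 0" "\<And>g n x. g \<in> Dp (ereal p) G S \<Longrightarrow> x \<in> carrier G \<Longrightarrow>
      \<bar>(lazy ^^ n) (drift g) x\<bar> \<le> K * real (Suc n) powr - (D / (2 * p)) * energy p g powr (1 / p)"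
    using increment_decay[OF p fast D] by blast
  define \<theta> where "\<theta> = 1 - p / q"
  have \<theta>: "\<theta> > 0" "D / (2 * p) * \<theta> = 2" using p q by (auto simp: \<theta>_def D_def field_simps)
  define E where "E = energy p g"
  define M where "M = (K * E powr (1 / p)) powr \<theta>"
  define w where "w = (\<lambda>n. M * real (Suc n) powr - 2)"
  have w: "summable w" "\<And>n. 0 \<le> w n"
  proof -
    show "summable w" unfolding w_def by (intro summable_mult summable_real_Suc_powr) simp
  qed (simp add: w_def M_def)
  define W where "W = suminf w"
  have wW: "sum w {..<n} \<le> W" for n unfolding W_def by (rule sum_le_suminf) (use w in auto)
  define F where "F = (\<lambda>n x. (lazy ^^ n) (drift g) x)"
  have Fle: "\<bar>F n x\<bar> \<le> w n * \<bar>F n x\<bar> powr (p / q)" if x: "x \<in> carrier G" for n x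
  proof (cases "F n x = 0")
    case False
    have "\<bar>F n x\<bar> powr \<theta> \<le> (K * real (Suc n) powr - (D / (2 * p)) * E powr (1 / p)) powr \<theta>"
      unfolding F_def E_def using \<theta> by (intro powr_mono2 K(2) g x) auto
    also have "\<dots> = w n"
      using K(1) \<theta>(2) by (simp add: w_def M_def powr_mult powr_powr)
    finally have "\<bar>F n x\<bar> powr \<theta> * \<bar>F n x\<bar> powr (p / q) \<le> w n * \<bar>F n x\<bar> powr (p / q)"
      by (intro mult_right_mono) auto
    then show ?thesis using False by (simp add: powr_add[symmetric] \<theta>_def)
  qed simp
  \<comment> \<open>Jensen with weights \<open>w i\<close> turns the exponent \<open>p / q\<close> back into \<open>p\<close>.\<close>
  have partial: "\<bar>(lazy ^^ n) g x - g x\<bar> powr q \<le> W powr (q - 1) * (\<Sum>i<n. w i * \<bar>F i x\<bar> powr p)"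
    if x: "x \<in> carrier G" for n x
  proof -
    have "\<bar>(lazy ^^ n) g x - g x\<bar> \<le> (\<Sum>i<n. \<bar>F i x\<bar>)"
      unfolding lazy_power_telescope[symmetric] F_def by (rule sum_abs)
    also have "\<dots> \<le> (\<Sum>i<n. w i * \<bar>F i x\<bar> powr (p / q))" by (intro sum_mono Fle x)
    also have "\<dots> = \<bar>\<dots>\<bar>" using w by (intro abs_of_nonneg[symmetric] sum_nonneg) auto
    finally have "\<bar>(lazy ^^ n) g x - g x\<bar> powr q \<le> \<bar>\<Sum>i<n. w i * \<bar>F i x\<bar> powr (p / q)\<bar> powr q"
      using p q by (intro powr_mono2) auto
    also have "\<dots> \<le> W powr (q - 1) * (\<Sum>i<n. w i * \<bar>\<bar>F i x\<bar> powr (p / q)\<bar> powr q)"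
      by (rule powr_sum_le) (use p q w wW in auto)
    also have "\<dots> = W powr (q - 1) * (\<Sum>i<n. w i * \<bar>F i x\<bar> powr p)"
      using p q by (simp add: powr_powr)
    finally show ?thesis .
  qed
  have bound: "(\<Sum>x\<in>X. \<bar>(lazy ^^ n) g x - g x\<bar> powr q) \<le> W powr (q - 1) * (W * E)"
    if X: "finite X" "X \<subseteq> carrier G" for X n
  proof -
    have "(\<Sum>x\<in>X. \<bar>(lazy ^^ n) g x - g x\<bar> powr q)
        \<le> (\<Sum>x\<in>X. W powr (q - 1) * (\<Sum>i<n. w i * \<bar>F i x\<bar> powr p))"
      using X by (intro sum_mono partial) auto
    also have "\<dots> = W powr (q - 1) * (\<Sum>i<n. w i * (\<Sum>x\<in>X. \<bar>F i x\<bar> powr p))"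
      unfolding sum_distrib_left[symmetric] by (subst sum.swap) (simp add: sum_distrib_left)
    also have "\<dots> \<le> W powr (q - 1) * (\<Sum>i<n. w i * E)"
    proof (intro mult_left_mono sum_mono)
      fix i
      show "(\<Sum>x\<in>X. \<bar>F i x\<bar> powr p) \<le> E"
        using lazy_power_powr_sum_bound[OF p drift_powr_sum(1)[OF p g] X, of i] drift_powr_sum(2)[OF p g]
        by (simp add: F_def E_def)
    qed (use w in auto)
    also have "\<dots> \<le> W powr (q - 1) * (W * E)"
      unfolding sum_distrib_right[symmetric]
      using wW by (intro mult_left_mono mult_right_mono) (auto simp: E_def)
    finally show ?thesis .
  qed
  show ?thesis
  proof (rule nonneg_bdd_above_summable_on)
    show "bdd_above (sum (\<lambda>x. \<bar>boundary_extension g x - g x\<bar> powr q) ` {F. F \<subseteq> carrier G \<and> finite F})"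
    proof (rule bdd_aboveI2)
      fix X assume "X \<in> {F. F \<subseteq> carrier G \<and> finite F}"
      then have X: "finite X" "X \<subseteq> carrier G" by auto
      have "(\<lambda>n. \<Sum>x\<in>X. \<bar>(lazy ^^ n) g x - g x\<bar> powr q)
          \<longlonglongrightarrow> (\<Sum>x\<in>X. \<bar>boundary_extension g x - g x\<bar> powr q)"
      proof (intro tendsto_sum)
        fix x assume "x \<in> X"
        then have l: "(\<lambda>n. (lazy ^^ n) g x) \<longlonglongrightarrow> boundary_extension g x"
          using boundary_extension_approx g X by blast
        show "(\<lambda>n. \<bar>(lazy ^^ n) g x - g x\<bar> powr q) \<longlonglongrightarrow> \<bar>boundary_extension g x - g x\<bar> powr q"
          by (rule tendsto_powr'[OF tendsto_rabs[OF tendsto_diff[OF l tendsto_const]] tendsto_const])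
             (use p q in auto)
      qed
      then show "(\<Sum>x\<in>X. \<bar>boundary_extension g x - g x\<bar> powr q) \<le> W powr (q - 1) * (W * E)"
        by (rule LIMSEQ_le_const2) (use bound[OF X] in auto)
    qed
  qed auto
qed

end

section \<open>Entropy and bounded harmonic functions\<close>

definition entropy :: "nat \<Rightarrow> real" where
  "entropy n = - total (\<lambda>x. walk n x * ln (walk n x))"

text \<open>The walk may also be decomposed at its first step, because left and right multiplications commute.
  The entropy argument needs this form: conditioning on the first step moves the starting point.\<close>
lemma walk_Suc_left:
  "z \<in> carrier G \<Longrightarrow> walk (Suc n) z = (\<Sum>t\<in>steps. walk n z + walk n (t \<otimes> z)) / (2 * valency)"
proof (induction n arbitrary: z)
  case 0
  have "z \<otimes> t = \<one> \<longleftrightarrow> t \<otimes> z = \<one>" if "t \<in> steps" for t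
    using that 0 inv_unique' inv_equality by (metis r_inv l_inv steps_closed)
  then show ?case by (simp add: lazy_def)
next
  case (Suc n)
  have "walk (Suc (Suc n)) z = (\<Sum>t\<in>steps. walk (Suc n) z + walk (Suc n) (z \<otimes> t)) / (2 * valency)"
    by (simp add: lazy_def)
  also have "(\<Sum>t\<in>steps. walk (Suc n) z + walk (Suc n) (z \<otimes> t))
      = (\<Sum>t\<in>steps. (\<Sum>s\<in>steps. walk n z + walk n (s \<otimes> z)) / (2 * valency)
          + (\<Sum>s\<in>steps. walk n (z \<otimes> t) + walk n (s \<otimes> (z \<otimes> t))) / (2 * valency))"
    using Suc by (intro sum.cong) auto
  also have "\<dots> = (\<Sum>t\<in>steps. \<Sum>s\<in>steps. ((walk n z + walk n (s \<otimes> z))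
          + (walk n (z \<otimes> t) + walk n (s \<otimes> (z \<otimes> t)))) / (2 * valency))"
    by (simp only: sum.distrib add_divide_distrib sum_divide_distrib)
  also have "\<dots> = (\<Sum>s\<in>steps. \<Sum>t\<in>steps. ((walk n z + walk n (z \<otimes> t))
          + (walk n (s \<otimes> z) + walk n (s \<otimes> z \<otimes> t))) / (2 * valency))"
    using Suc.prems by (subst sum.swap) (intro sum.cong refl, simp add: m_assoc)
  also have "\<dots> = (\<Sum>s\<in>steps. walk (Suc n) z + walk (Suc n) (s \<otimes> z))"
    by (simp only: walk.simps lazy_def sum.distrib add_divide_distrib sum_divide_distrib)
  finally show ?case .
qed

definition hellinger :: "('a \<Rightarrow> real) \<Rightarrow> ('a \<Rightarrow> real) \<Rightarrow> real" where
  "hellinger f h = total (\<lambda>x. (sqrt (f x) - sqrt (h x))\<^sup>2)"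

lemma hellinger_nonneg: "0 \<le> hellinger f h"
  by (simp add: hellinger_def infsum_nonneg)

lemma fin_supp_sqrt_diff_square:
  "fin_supp f \<Longrightarrow> fin_supp h \<Longrightarrow> fin_supp (\<lambda>x. (sqrt (f x) - sqrt (h x))\<^sup>2)"
  by (intro fin_supp_square fin_supp_diff) (auto elim: fin_supp_mono)

text \<open>Before averaging over the first step, each of the distributions \<open>walk n\<close> and
  \<open>\<lambda>z. walk n (t \<otimes> z)\<close> has the entropy of \<open>walk n\<close>; after averaging, the entropy is that of
  \<open>walk (Suc n)\<close>. The increase is therefore an average of relative entropies with respect to
  \<open>walk (Suc n)\<close>, which dominate the Hellinger distances.\<close>
lemma entropy_increment:
  "(\<Sum>t\<in>steps. hellinger (walk n) (walk (Suc n)) + hellinger (\<lambda>z. walk n (t \<otimes> z)) (walk (Suc n)))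
    \<le> 2 * valency * (entropy (Suc n) - entropy n)"
proof -
  define W where "W = walk n"
  define B where "B = walk (Suc n)"
  have fW: "fin_supp W" and fB: "fin_supp B" and fWt: "\<And>t. t \<in> steps \<Longrightarrow> fin_supp (\<lambda>z. W (t \<otimes> z))"
    by (auto simp: W_def B_def intro: fin_supp_left_translation[of _ "walk n"] simp del: walk.simps)
  have nn: "0 \<le> W z" "0 \<le> B z" for z by (auto simp: W_def B_def simp del: walk.simps)
  have Bsum: "2 * valency * B z = (\<Sum>t\<in>steps. W z + W (t \<otimes> z))" if "z \<in> carrier G" for z
    using walk_Suc_left[OF that, of n] by (simp add: W_def B_def del: walk.simps)
  have zero: "W z = 0" "t \<in> steps \<Longrightarrow> W (t \<otimes> z) = 0" if "z \<in> carrier G" "B z = 0" for z t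
  proof -
    have "(\<Sum>t\<in>steps. W z + W (t \<otimes> z)) = 0" using Bsum[OF that(1)] that(2) by simp
    then have *: "W z + W (t \<otimes> z) = 0" if "t \<in> steps" for t
      using sum_nonneg_eq_0_iff[of steps "\<lambda>t. W z + W (t \<otimes> z)"] nn that by (simp add: add_nonneg_nonneg)
    obtain s where "s \<in> steps" using steps_nonempty by blast
    from *[OF this] show "W z = 0" using nn(1)[of z] nn(1)[of "s \<otimes> z"] by linarith
    show "t \<in> steps \<Longrightarrow> W (t \<otimes> z) = 0"
      using *[of t] nn(1)[of z] nn(1)[of "t \<otimes> z"] by linarith
  qed
  define \<eta> :: "real \<Rightarrow> real" where "\<eta> = (\<lambda>x. x * ln x)"
  have pt: "(\<Sum>t\<in>steps. (sqrt (W z) - sqrt (B z))\<^sup>2 + (sqrt (W (t \<otimes> z)) - sqrt (B z))\<^sup>2)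
      \<le> (\<Sum>t\<in>steps. \<eta> (W z) + \<eta> (W (t \<otimes> z))) - 2 * valency * \<eta> (B z)" if z: "z \<in> carrier G" for z
  proof -
    have "(\<Sum>t\<in>steps. ((sqrt (W z) - sqrt (B z))\<^sup>2 + W z - B z) + ((sqrt (W (t \<otimes> z)) - sqrt (B z))\<^sup>2 + W (t \<otimes> z) - B z))
      \<le> (\<Sum>t\<in>steps. (W z * ln (W z) - W z * ln (B z)) + (W (t \<otimes> z) * ln (W (t \<otimes> z)) - W (t \<otimes> z) * ln (B z)))"
      using nn zero[OF z] by (intro sum_mono add_mono relative_entropy_ge_hellinger) auto
    also have "\<dots> = (\<Sum>t\<in>steps. \<eta> (W z) + \<eta> (W (t \<otimes> z))) - (\<Sum>t\<in>steps. W z + W (t \<otimes> z)) * ln (B z)"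
      unfolding \<eta>_def sum_distrib_right sum_subtractf[symmetric]
      by (rule sum.cong) (auto simp: algebra_simps)
    finally have "(\<Sum>t\<in>steps. ((sqrt (W z) - sqrt (B z))\<^sup>2 + W z - B z) + ((sqrt (W (t \<otimes> z)) - sqrt (B z))\<^sup>2 + W (t \<otimes> z) - B z))
      \<le> (\<Sum>t\<in>steps. \<eta> (W z) + \<eta> (W (t \<otimes> z))) - 2 * valency * \<eta> (B z)"
      unfolding Bsum[OF z, symmetric] \<eta>_def by (simp add: mult.assoc)
    moreover have "(\<Sum>t\<in>steps. ((sqrt (W z) - sqrt (B z))\<^sup>2 + W z - B z) + ((sqrt (W (t \<otimes> z)) - sqrt (B z))\<^sup>2 + W (t \<otimes> z) - B z))
       = (\<Sum>t\<in>steps. (sqrt (W z) - sqrt (B z))\<^sup>2 + (sqrt (W (t \<otimes> z)) - sqrt (B z))\<^sup>2)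
         + ((\<Sum>t\<in>steps. W z + W (t \<otimes> z)) - (\<Sum>t\<in>steps. 2 * B z))"
      unfolding sum.distrib[symmetric] sum_subtractf[symmetric] by (rule sum.cong) auto
    moreover have "(\<Sum>t\<in>steps. W z + W (t \<otimes> z)) - (\<Sum>t\<in>steps. 2 * B z) = 0"
      using Bsum[OF z] by simp
    ultimately show ?thesis by linarith
  qed
  have f\<eta>: "fin_supp (\<lambda>z. \<eta> (W z))" "fin_supp (\<lambda>z. \<eta> (B z))" "t \<in> steps \<Longrightarrow> fin_supp (\<lambda>z. \<eta> (W (t \<otimes> z)))" for t
    unfolding \<eta>_def by (intro fin_supp_mult_left fW fB fWt; assumption)+
  have fh: "fin_supp (\<lambda>z. (sqrt (W z) - sqrt (B z))\<^sup>2)"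
    "t \<in> steps \<Longrightarrow> fin_supp (\<lambda>z. (sqrt (W (t \<otimes> z)) - sqrt (B z))\<^sup>2)" for t
    by (intro fin_supp_sqrt_diff_square fW fB fWt; assumption)+
  have tW: "total (\<lambda>z. \<eta> (W z)) = - entropy n" by (simp add: entropy_def \<eta>_def W_def)
  have tB: "total (\<lambda>z. \<eta> (B z)) = - entropy (Suc n)" by (simp add: entropy_def \<eta>_def B_def)
  have tWt: "total (\<lambda>z. \<eta> (W (t \<otimes> z))) = - entropy n" if "t \<in> steps" for t
    using infsum_left_translation[of t "\<lambda>z. \<eta> (W z)"] that tW by simp
  have "(\<Sum>t\<in>steps. hellinger W B + hellinger (\<lambda>z. W (t \<otimes> z)) B)
      = total (\<lambda>z. \<Sum>t\<in>steps. (sqrt (W z) - sqrt (B z))\<^sup>2 + (sqrt (W (t \<otimes> z)) - sqrt (B z))\<^sup>2)"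
    by (simp add: hellinger_def total_sum total_add fin_supp_add fh)
  also have "\<dots> \<le> total (\<lambda>z. (\<Sum>t\<in>steps. \<eta> (W z) + \<eta> (W (t \<otimes> z))) - 2 * valency * \<eta> (B z))"
    by (rule total_mono[OF _ _ pt])
       (auto intro!: fin_supp_sum fin_supp_add fin_supp_diff fin_supp_mult_right f\<eta> fh)
  also have "\<dots> = (\<Sum>t\<in>steps. - entropy n + - entropy n) - 2 * valency * (- entropy (Suc n))"
    by (simp add: total_diff total_sum total_add fin_supp_sum fin_supp_add fin_supp_mult_right f\<eta>
        infsum_cmult_right' tW tB tWt)
  also have "\<dots> = 2 * valency * (entropy (Suc n) - entropy n)" by (simp add: algebra_simps)
  finally show ?thesis by (simp only: W_def B_def)
qed

lemma entropy_0: "entropy 0 = 0"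
proof -
  have "total (\<lambda>x. walk 0 x * ln (walk 0 x)) = total (\<lambda>x. 0)" by (rule infsum_cong) simp
  then show ?thesis by (simp add: entropy_def)
qed

text \<open>The uniform distribution maximises the entropy; the inequality \<open>ln x \<le> x - 1\<close> proves it.\<close>
lemma entropy_le_ln_card_ball: "entropy n \<le> ln (real (card (ball_of n)))"
proof -
  define N where "N = real (card (ball_of n))"
  have N: "N > 0" using card_ball_pos by (simp add: N_def)
  have cN: "real (card (ball_of n)) = N" by (simp add: N_def)
  have pt: "- (w * ln w) - w * ln N \<le> 1 / N - w" if w: "0 \<le> w" for w :: real
  proof (cases "w = 0")
    case False
    then have w: "w > 0" using that by simp
    have "ln (1 / (w * N)) \<le> 1 / (w * N) - 1" using w N by (intro ln_le_minus_one) auto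
    then have "w * ln (1 / (w * N)) \<le> w * (1 / (w * N) - 1)" using w by (intro mult_left_mono) auto
    also have "\<dots> = 1 / N - w" using w N by (simp add: field_simps)
    finally show ?thesis using w N by (simp add: ln_div ln_mult algebra_simps)
  qed (use N in simp)
  have "entropy n - ln N = - (\<Sum>x\<in>ball_of n. walk n x * ln (walk n x)) - (\<Sum>x\<in>ball_of n. walk n x) * ln N"
    by (simp add: entropy_def total_walk_mult sum_walk_ball)
  also have "\<dots> = (\<Sum>x\<in>ball_of n. - (walk n x * ln (walk n x)) - walk n x * ln N)"
    by (simp add: sum_distrib_right sum_subtractf sum_negf)
  also have "\<dots> \<le> (\<Sum>x\<in>ball_of n. 1 / N - walk n x)" by (intro sum_mono pt) simp
  also have "\<dots> = 0" using N by (simp add: sum_subtractf sum_walk_ball cN)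
  finally show ?thesis by (simp add: N_def)
qed

text \<open>Increments bounded below by \<open>e\<close> would make the entropy grow linearly, hence the balls
  exponentially.\<close>
lemma small_entropy_increment:
  assumes slow: "\<not> growth_at_least_degree G S D" and e: "e > 0"
  shows "\<exists>n. entropy (Suc n) - entropy n < e"
proof (rule ccontr)
  assume "\<not> ?thesis"
  then have inc: "entropy (Suc n) \<ge> entropy n + e" for n by (simp add: not_less algebra_simps)
  have lin: "entropy n \<ge> real n * e" for n
  proof (induction n)
    case (Suc n)
    then show ?case using inc[of n] by (simp add: algebra_simps)
  qed (simp add: entropy_0)
  have "growth G S n \<ge> exp (e * real n)" for n
  proof -
    have "exp (e * real n) \<le> exp (ln (real (card (ball_of n))))"
      using lin[of n] entropy_le_ln_card_ball[of n] by (simp add: mult.commute)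
    also have "\<dots> = growth G S n" using card_ball_pos[of n] by (simp add: growth_def)
    finally show ?thesis .
  qed
  then have "(\<lambda>n. exp (e * real n)) \<in> O(growth G S)"
    by (intro landau_o.big_mono always_eventually allI) (simp add: growth_def)
  moreover have "(\<lambda>n. real n powr D) \<in> O(\<lambda>n. exp (e * real n))" using e by real_asymp
  ultimately have "(\<lambda>n. real n powr D) \<in> O(growth G S)" by (rule landau_o.big_trans[rotated])
  then show False using slow by (simp add: growth_at_least_degree_def bigomega_iff_bigo)
qed

text \<open>A harmonic function is at each point the average of its values along the walk from there, over any
  number of steps. For the walk of length \<open>Suc n\<close> from \<open>x\<close> and the walk of length \<open>n\<close> from a neighbour of \<open>x\<close>
  the distributions are close whenever the \<open>n\<close>-th entropy increment is small.\<close>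
lemma bounded_harmonic_constant:
  assumes slow: "\<not> growth_at_least_degree G S D"
    and f: "f \<in> harmonic G S" and M: "\<And>x. x \<in> carrier G \<Longrightarrow> \<bar>f x\<bar> \<le> M"
  shows "f constant_on carrier G"
proof -
  have M0: "0 \<le> M" using M[OF one_closed] by linarith
  have lazyf: "lazy f x = f x" if "x \<in> carrier G" for x
    using f that by (simp add: harmonic_iff_lazy)
  have pow: "(lazy ^^ n) f x = f x" if "x \<in> carrier G" for n x
    using that
  proof (induction n arbitrary: x)
    case (Suc n)
    have "(lazy ^^ Suc n) f x = lazy f x"
      using Suc.prems by (simp add: lazy_def[of _ x] Suc.IH)
    then show ?case using lazyf Suc by simp
  qed simp
  have rep: "f x = total (\<lambda>y. walk n y * f (x \<otimes> y))" if "x \<in> carrier G" for n x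
    using pow[OF that, of n] by (simp add: lazy_power_eq_walk_average[OF that])
  have step: "f (x \<otimes> inv t) = f x" if x: "x \<in> carrier G" and t: "t \<in> steps" for x t
  proof -
    have bound: "\<bar>f x - f (x \<otimes> inv t)\<bar> \<le> M * (l * valency * (entropy (Suc n) - entropy n) + 2 / l)"
      if l: "l > 0" for l n
    proof -
      have ft: "fin_supp (\<lambda>z. walk n (t \<otimes> z))" using t by (intro fin_supp_left_translation[of t "walk n"]) auto
      have fS: "fin_supp (walk (Suc n))" by (rule walk_fin_supp)
      have "f (x \<otimes> inv t) = total (\<lambda>y. walk n (t \<otimes> (inv t \<otimes> y)) * f (x \<otimes> (inv t \<otimes> y)))"
        unfolding rep[of "x \<otimes> inv t" n, OF m_closed[OF x inv_closed[OF steps_closed[OF t]]]]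
        by (rule infsum_cong) (use x t in \<open>simp add: m_assoc[symmetric]\<close>)
      also have "\<dots> = total (\<lambda>z. walk n (t \<otimes> z) * f (x \<otimes> z))"
        using infsum_left_translation[of "inv t" "\<lambda>z. walk n (t \<otimes> z) * f (x \<otimes> z)"] t by simp
      finally have "f x - f (x \<otimes> inv t) = total (\<lambda>z. walk (Suc n) z * f (x \<otimes> z)) - total (\<lambda>z. walk n (t \<otimes> z) * f (x \<otimes> z))"
        using rep[OF x, of "Suc n"] by simp
      also have "\<dots> = total (\<lambda>z. walk (Suc n) z * f (x \<otimes> z) - walk n (t \<otimes> z) * f (x \<otimes> z))"
        by (rule total_diff[symmetric]; rule fin_supp_mult_left; fact)
      finally have eq: "f x - f (x \<otimes> inv t) = total (\<lambda>z. (walk (Suc n) z - walk n (t \<otimes> z)) * f (x \<otimes> z))"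
        by (simp add: left_diff_distrib)
      have fd: "fin_supp (\<lambda>z. walk (Suc n) z - walk n (t \<otimes> z))" by (intro fin_supp_diff fS ft)
      have "\<bar>f x - f (x \<otimes> inv t)\<bar> \<le> total (\<lambda>z. norm ((walk (Suc n) z - walk n (t \<otimes> z)) * f (x \<otimes> z)))"
        unfolding eq real_norm_def[symmetric]
        by (rule norm_infsum_bound) (rule fin_supp_summable, rule fin_supp_mono[OF fd], simp)
      also have "\<dots> \<le> total (\<lambda>z. M * (l / 2 * (sqrt (walk n (t \<otimes> z)) - sqrt (walk (Suc n) z))\<^sup>2
          + 1 / l * (walk n (t \<otimes> z) + walk (Suc n) z)))"
      proof (rule total_mono)
        show "fin_supp (\<lambda>z. norm ((walk (Suc n) z - walk n (t \<otimes> z)) * f (x \<otimes> z)))"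
          by (rule fin_supp_mono[OF fd]) simp
        show "fin_supp (\<lambda>z. M * (l / 2 * (sqrt (walk n (t \<otimes> z)) - sqrt (walk (Suc n) z))\<^sup>2
          + 1 / l * (walk n (t \<otimes> z) + walk (Suc n) z)))"
          by (intro fin_supp_mult_right fin_supp_add fin_supp_sqrt_diff_square ft fS)
      next
        fix z assume z: "z \<in> carrier G"
        have "norm ((walk (Suc n) z - walk n (t \<otimes> z)) * f (x \<otimes> z)) = \<bar>f (x \<otimes> z)\<bar> * \<bar>walk n (t \<otimes> z) - walk (Suc n) z\<bar>"
          by (simp add: abs_mult abs_minus_commute mult.commute)
        also have "\<dots> \<le> M * (l / 2 * (sqrt (walk n (t \<otimes> z)) - sqrt (walk (Suc n) z))\<^sup>2
          + 1 / l * (walk n (t \<otimes> z) + walk (Suc n) z))"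
          using M[of "x \<otimes> z"] x z M0 l by (intro mult_mono abs_diff_le_hellinger walk_nonneg) auto
        finally show "norm ((walk (Suc n) z - walk n (t \<otimes> z)) * f (x \<otimes> z)) \<le> \<dots>" .
      qed
      also have "\<dots> = M * (l / 2 * hellinger (\<lambda>z. walk n (t \<otimes> z)) (walk (Suc n)) + 1 / l * (total (\<lambda>z. walk n (t \<otimes> z)) + total (walk (Suc n))))"
        unfolding hellinger_def infsum_cmult_right'
        by (subst total_add) (intro fin_supp_mult_right fin_supp_add fin_supp_sqrt_diff_square ft fS,
            intro fin_supp_mult_right fin_supp_add fin_supp_sqrt_diff_square ft fS,
            simp only: infsum_cmult_right' total_add[OF ft fS])
      also have "total (\<lambda>z. walk n (t \<otimes> z)) = 1"
        using infsum_left_translation[of t "walk n"] t by simp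
      also have "total (walk (Suc n)) = 1" by (rule total_walk)
      also have "hellinger (\<lambda>z. walk n (t \<otimes> z)) (walk (Suc n)) \<le> 2 * valency * (entropy (Suc n) - entropy n)"
      proof -
        have "hellinger (\<lambda>z. walk n (t \<otimes> z)) (walk (Suc n))
            \<le> hellinger (walk n) (walk (Suc n)) + hellinger (\<lambda>z. walk n (t \<otimes> z)) (walk (Suc n))"
          using hellinger_nonneg[of "walk n" "walk (Suc n)"] by linarith
        also have "\<dots> \<le> (\<Sum>t\<in>steps. hellinger (walk n) (walk (Suc n)) + hellinger (\<lambda>z. walk n (t \<otimes> z)) (walk (Suc n)))"
          by (rule member_le_sum[OF t, of "\<lambda>t. hellinger (walk n) (walk (Suc n)) + hellinger (\<lambda>z. walk n (t \<otimes> z)) (walk (Suc n))"])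
             (auto intro!: add_nonneg_nonneg hellinger_nonneg simp del: walk.simps)
        also have "\<dots> \<le> 2 * valency * (entropy (Suc n) - entropy n)" by (rule entropy_increment)
        finally show ?thesis .
      qed
      finally show ?thesis using M0 l by (simp add: mult_left_mono mult.assoc)
    qed
    have "\<bar>f x - f (x \<otimes> inv t)\<bar> \<le> e" if e: "e > 0" for e
    proof -
      \<comment> \<open>First \<open>l\<close> makes the term \<open>2 / l\<close> small, then \<open>n\<close> the entropy term.\<close>
      define l where "l = 4 * (M + 1) / e"
      define r where "r = e / (2 * (M + 1))"
      have l: "l > 0" using M0 e by (simp add: l_def)
      define e' where "e' = e / (2 * (M + 1) * l * valency)"
      have e': "e' > 0" using M0 e l by (simp add: e'_def)
      obtain n where n: "entropy (Suc n) - entropy n < e'" using small_entropy_increment[OF slow e'] by blast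
      have "l * valency * (entropy (Suc n) - entropy n) \<le> l * valency * e'"
        using n l by (intro mult_left_mono) auto
      also have "\<dots> = r" using l by (simp add: e'_def r_def)
      finally have "l * valency * (entropy (Suc n) - entropy n) \<le> r" .
      moreover have "2 / l = r" using M0 e by (simp add: l_def r_def field_simps)
      ultimately have "M * (l * valency * (entropy (Suc n) - entropy n) + 2 / l) \<le> M * (2 * r)"
        using M0 by (intro mult_left_mono) auto
      also have "\<dots> \<le> (M + 1) * (2 * r)" using M0 e by (intro mult_right_mono) (auto simp: r_def)
      also have "\<dots> = 2 * (M + 1) * r" by (simp only: mult_ac)
      also have "\<dots> = e"
        unfolding r_def times_divide_eq_right by (rule nonzero_mult_div_cancel_left) (use M0 in simp)
      finally show ?thesis using bound[OF l, of n] by linarith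
    qed
    then have "\<bar>f x - f (x \<otimes> inv t)\<bar> \<le> 0" by (rule field_le_epsilon) simp
    then show ?thesis by simp
  qed
  have "f x = f \<one>" if "x \<in> carrier G" for x
    using that
  proof (induction rule: carrier_induct)
    case (step y t)
    then show ?case using \<open>\<And>x t. x \<in> carrier G \<Longrightarrow> t \<in> steps \<Longrightarrow> f (x \<otimes> inv t) = f x\<close>[of y "inv t"] by simp
  qed simp
  then show ?thesis unfolding constant_on_def by blast
qed

section \<open>Limits at infinity\<close>

lemma superpolynomial_of_fast_growth:
  assumes fast: "\<And>D. growth_at_least_degree G S D"
  shows "superpolynomial_growth G S"
  unfolding superpolynomial_growth_def
proof (intro allI notI)
  fix k assume O: "growth G S \<in> O(\<lambda>n. real n ^ k)"
  have "(\<lambda>n. real n powr (real k + 1)) \<in> O(growth G S)"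
    using fast[of "real k + 1"] by (simp add: growth_at_least_degree_def bigomega_iff_bigo)
  from landau_o.big_trans[OF this O] have "(\<lambda>n. real n powr (real k + 1)) \<in> O(\<lambda>n. real n ^ k)" .
  moreover have "(\<lambda>n. real n ^ k) \<in> o(\<lambda>n. real n powr (real k + 1))" by real_asymp
  ultimately have "(\<lambda>n. real n ^ k) \<in> o(\<lambda>n. real n ^ k)" by (rule landau_o.small_big_trans[rotated])
  then have "eventually (\<lambda>n. real n ^ k = 0) sequentially" by (simp add: landau_o.small_refl_iff)
  then have "eventually (\<lambda>n::nat. False) sequentially"
    using eventually_gt_at_top[of 0] by eventually_elim auto
  then show False by simp
qed

lemma Dp_mono_bounded:
  assumes g: "g \<in> Dp (ereal p) G S" and p: "0 \<le> p" "p \<le> q"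
    and M: "\<And>x. x \<in> carrier G \<Longrightarrow> \<bar>g x\<bar> \<le> M"
  shows "g \<in> Dp (ereal q) G S"
  unfolding Dp_iff
proof
  fix t assume t: "t \<in> steps"
  have s: "(\<lambda>x. (2 * M) powr (q - p) * \<bar>g (x \<otimes> t) - g x\<bar> powr p) summable_on carrier G"
    using g t by (intro summable_on_cmult_right) (simp add: Dp_iff)
  show "(\<lambda>x. \<bar>g (x \<otimes> t) - g x\<bar> powr q) summable_on carrier G"
  proof (rule nonneg_summable_on_leI[OF s])
    fix x assume x: "x \<in> carrier G"
    have "\<bar>g (x \<otimes> t) - g x\<bar> \<le> 2 * M" using M[of x] M[of "x \<otimes> t"] x t by simp
    then have "\<bar>g (x \<otimes> t) - g x\<bar> powr (q - p) \<le> (2 * M) powr (q - p)"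
      using p by (intro powr_mono2) auto
    then have "\<bar>g (x \<otimes> t) - g x\<bar> powr (q - p) * \<bar>g (x \<otimes> t) - g x\<bar> powr p
        \<le> (2 * M) powr (q - p) * \<bar>g (x \<otimes> t) - g x\<bar> powr p" by (intro mult_right_mono) auto
    then show "\<bar>g (x \<otimes> t) - g x\<bar> powr q \<le> (2 * M) powr (q - p) * \<bar>g (x \<otimes> t) - g x\<bar> powr p"
      by (simp add: powr_add[symmetric])
  qed simp
qed

lemma Dp_of_summable:
  assumes h: "(\<lambda>x. \<bar>h x\<bar> powr q) summable_on carrier G" and q: "0 \<le> q"
  shows "h \<in> Dp (ereal q) G S"
  unfolding Dp_iff
proof
  fix t assume t: "t \<in> steps"
  have "(\<lambda>x. \<bar>h (x \<otimes> t)\<bar> powr q) summable_on carrier G"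
    using summable_right_translation[of t "\<lambda>x. \<bar>h x\<bar> powr q"] h t by simp
  from summable_on_cmult_right[OF summable_on_add[OF this h], of "2 powr q"]
  show "(\<lambda>x. \<bar>h (x \<otimes> t) - h x\<bar> powr q) summable_on carrier G"
  proof (rule nonneg_summable_on_leI)
    fix x show "\<bar>h (x \<otimes> t) - h x\<bar> powr q \<le> 2 powr q * (\<bar>h (x \<otimes> t)\<bar> powr q + \<bar>h x\<bar> powr q)"
      using powr_add_le[OF q, of "h (x \<otimes> t)" "- h x"] by simp
  qed simp
qed

lemma Dp_add:
  assumes f: "f \<in> Dp (ereal q) G S" and h: "h \<in> Dp (ereal q) G S" and q: "0 \<le> q"
  shows "(\<lambda>x. f x + h x) \<in> Dp (ereal q) G S"
  unfolding Dp_iff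
proof
  fix t assume t: "t \<in> steps"
  have "(\<lambda>x. 2 powr q * (\<bar>f (x \<otimes> t) - f x\<bar> powr q + \<bar>h (x \<otimes> t) - h x\<bar> powr q)) summable_on carrier G"
    using f h t by (intro summable_on_cmult_right summable_on_add) (auto simp: Dp_iff)
  then show "(\<lambda>x. \<bar>f (x \<otimes> t) + h (x \<otimes> t) - (f x + h x)\<bar> powr q) summable_on carrier G"
  proof (rule nonneg_summable_on_leI)
    fix x show "\<bar>f (x \<otimes> t) + h (x \<otimes> t) - (f x + h x)\<bar> powr q
        \<le> 2 powr q * (\<bar>f (x \<otimes> t) - f x\<bar> powr q + \<bar>h (x \<otimes> t) - h x\<bar> powr q)"
      using powr_add_le[OF q, of "f (x \<otimes> t) - f x" "h (x \<otimes> t) - h x"] by (simp add: algebra_simps)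
  qed simp
qed

lemma bounded_Dp_infinity:
  assumes "\<And>x. x \<in> carrier G \<Longrightarrow> \<bar>f x\<bar> \<le> M"
  shows "f \<in> Dp \<infinity> G S" and "f \<in> ell \<infinity> (carrier G)"
proof -
  have "\<bar>grad f e\<bar> \<le> 2 * M" if "e \<in> cayley_edges G S" for e
  proof -
    obtain x y where e: "e = (x, y)" by (cases e)
    then have "x \<in> carrier G" "y \<in> carrier G" using that by (auto simp: cayley_edges_def)
    then show ?thesis using assms[of x] assms[of y] by (simp add: e grad_def)
  qed
  then show "f \<in> Dp \<infinity> G S" by (auto simp: Dp_def ell_def bounded_iff intro!: exI[of _ "2 * M"])
  show "f \<in> ell \<infinity> (carrier G)" using assms by (auto simp: ell_def bounded_iff)
qed

text \<open>Truncation is a contraction of the real line.\<close>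
lemma clamp_Dp:
  fixes T :: real
  assumes p: "0 \<le> p" and g: "g \<in> Dp (ereal p) G S" and T: "T \<ge> 0"
  defines "c \<equiv> \<lambda>x. max (- T) (min T (g x))"
  shows "c \<in> Dp (ereal p) G S" and "energy p c \<le> energy p g"
proof -
  have le: "\<bar>c y - c x\<bar> powr p \<le> \<bar>g y - g x\<bar> powr p" for x y
    using p T by (intro powr_mono2) (auto simp: c_def max_def min_def)
  have s: "(\<lambda>x. \<bar>g (x \<otimes> t) - g x\<bar> powr p) summable_on carrier G"
    and sc: "(\<lambda>x. \<bar>c (x \<otimes> t) - c x\<bar> powr p) summable_on carrier G" if t: "t \<in> steps" for t
  proof -
    show s: "(\<lambda>x. \<bar>g (x \<otimes> t) - g x\<bar> powr p) summable_on carrier G" using g t by (simp add: Dp_iff)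
    show "(\<lambda>x. \<bar>c (x \<otimes> t) - c x\<bar> powr p) summable_on carrier G"
      by (rule nonneg_summable_on_leI[OF s]) (auto intro: le)
  qed
  show "c \<in> Dp (ereal p) G S" using sc by (simp add: Dp_iff)
  show "energy p c \<le> energy p g"
    unfolding energy_def by (intro sum_mono infsum_mono sc s le)
qed

text \<open>In the case distinction on the growth, the failure of a lower bound of some degree is what the entropy argument
  uses, while lower bounds of all degrees imply superpolynomial growth.\<close>
lemma limit_at_infinity:
  assumes p: "1 \<le> p" and gr: "growth_at_least_degree G S d" and d: "d > 2 * p"
    and liouville: "superpolynomial_growth G S \<Longrightarrow>
      \<exists>q>ereal p. \<forall>f \<in> HDp q G S \<inter> ell \<infinity> (carrier G). f constant_on carrier G"
  shows "\<exists>K\<ge>0. \<forall>g\<in>Dp (ereal p) G S. \<exists>a. (\<forall>x\<in>carrier G. \<bar>g x - a\<bar> \<le> K * energy p g powr (1 / p)) \<and>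
    (\<forall>e>0. finite {x \<in> carrier G. \<bar>g x - a\<bar> \<ge> e})"
proof -
  obtain K where K: "K \<ge> 0" and approx: "\<And>g x. g \<in> Dp (ereal p) G S \<Longrightarrow> x \<in> carrier G \<Longrightarrow>
      \<bar>boundary_extension g x - g x\<bar> \<le> K * energy p g powr (1 / p)"
    and fin: "\<And>g e. g \<in> Dp (ereal p) G S \<Longrightarrow> e > 0 \<Longrightarrow>
      finite {x \<in> carrier G. \<bar>boundary_extension g x - g x\<bar> \<ge> e}"
    using boundary_extension_approx[OF p gr d] by blast
  have const: "boundary_extension g constant_on carrier G"
    if g: "g \<in> Dp (ereal p) G S" and M: "\<And>x. x \<in> carrier G \<Longrightarrow> \<bar>g x\<bar> \<le> M" for g M
  proof -
    define u where "u = boundary_extension g"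
    define B where "B = M + K * energy p g powr (1 / p)"
    have harm: "u \<in> harmonic G S" unfolding u_def by (rule boundary_extension_harmonic[OF p gr d g])
    have bd: "\<bar>u x\<bar> \<le> B" if "x \<in> carrier G" for x
      using approx[OF g that] M[OF that] by (simp add: u_def B_def)
    show ?thesis
    proof (cases "\<forall>D. growth_at_least_degree G S D")
      case True
      then obtain q where q: "q > ereal p" "\<And>f. f \<in> HDp q G S \<inter> ell \<infinity> (carrier G) \<Longrightarrow> f constant_on carrier G"
        using liouville[OF superpolynomial_of_fast_growth] by blast
      have "u \<in> Dp q G S"
      proof (cases q)
        case (real r)
        then have pr: "p < r" using q(1) by simp
        have "(\<lambda>x. u x - g x) \<in> Dp (ereal r) G S"
          unfolding u_def using True p pr
          by (intro Dp_of_summable boundary_extension_q_summable[OF p gr d g pr]) auto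
        moreover have "g \<in> Dp (ereal r) G S"
          using Dp_mono_bounded[OF g _ _ M] p pr by simp
        ultimately have "(\<lambda>x. (u x - g x) + g x) \<in> Dp (ereal r) G S"
          using p pr by (intro Dp_add) auto
        then show ?thesis by (simp add: real)
      next
        case PInf
        then show ?thesis using bounded_Dp_infinity(1)[OF bd] by simp
      qed (use q in simp)
      then have "u \<in> HDp q G S \<inter> ell \<infinity> (carrier G)"
        using harm bounded_Dp_infinity(2)[OF bd] by (simp add: HDp_def)
      then show ?thesis using q(2) by (simp add: u_def)
    next
      case False
      then show ?thesis using bounded_harmonic_constant[OF _ harm bd] by (auto simp: u_def)
    qed
  qed
  have bounded: "\<bar>g x - g \<one>\<bar> \<le> 2 * (K * energy p g powr (1 / p))"
    if g: "g \<in> Dp (ereal p) G S" and x: "x \<in> carrier G" for g x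
  proof -
    \<comment> \<open>Truncated at this height, \<open>g\<close> is bounded and keeps its values at \<open>x\<close> and \<open>\<one>\<close>.\<close>
    define T where "T = max \<bar>g x\<bar> \<bar>g \<one>\<bar>"
    define c where "c = (\<lambda>x. max (- T) (min T (g x)))"
    have T: "T \<ge> 0" by (simp add: T_def)
    have c: "c \<in> Dp (ereal p) G S" "energy p c \<le> energy p g"
      unfolding c_def using clamp_Dp[OF _ g T] p by auto
    have "boundary_extension c constant_on carrier G"
      by (rule const[OF c(1), of T]) (use T in \<open>auto simp: c_def\<close>)
    then have eq: "boundary_extension c x = boundary_extension c \<one>"
      using x by (auto simp: constant_on_def)
    have "K * energy p c powr (1 / p) \<le> K * energy p g powr (1 / p)"
      using K c p by (intro mult_left_mono powr_mono2) auto
    then have "\<bar>c x - c \<one>\<bar> \<le> 2 * (K * energy p g powr (1 / p))"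
      using approx[OF c(1) x] approx[OF c(1) one_closed] eq by linarith
    moreover have "c x = g x" "c \<one> = g \<one>" by (auto simp: c_def T_def)
    ultimately show ?thesis by simp
  qed
  have "\<exists>a. (\<forall>x\<in>carrier G. \<bar>g x - a\<bar> \<le> K * energy p g powr (1 / p)) \<and>
    (\<forall>e>0. finite {x \<in> carrier G. \<bar>g x - a\<bar> \<ge> e})" if g: "g \<in> Dp (ereal p) G S" for g
  proof -
    have "boundary_extension g constant_on carrier G"
      by (rule const[OF g, of "\<bar>g \<one>\<bar> + 2 * (K * energy p g powr (1 / p))"])
         (use bounded[OF g] in \<open>smt (verit)\<close>)
    then obtain a where a: "\<And>x. x \<in> carrier G \<Longrightarrow> boundary_extension g x = a"
      by (auto simp: constant_on_def)
    have "{x \<in> carrier G. \<bar>g x - a\<bar> \<ge> e} = {x \<in> carrier G. \<bar>boundary_extension g x - g x\<bar> \<ge> e}" for e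
      using a by (auto simp: abs_minus_commute)
    then show ?thesis using approx[OF g] fin[OF g] a by (auto simp: abs_minus_commute intro!: exI[of _ a])
  qed
  then show ?thesis using K by blast
qed

end

section \<open>Semidirect products\<close>

lemma (in group) commute_of_commutator_one:
  assumes "x \<in> carrier G" "y \<in> carrier G" "commutator G x y = \<one>"
  shows "x \<otimes> y = y \<otimes> x"
proof -
  have "x \<otimes> y = x \<otimes> y \<otimes> (inv (y \<otimes> x) \<otimes> (y \<otimes> x))"
    using assms(1,2) by (simp del: inv_mult_group)
  also have "\<dots> = commutator G x y \<otimes> (y \<otimes> x)"
    using assms(1,2) by (simp add: commutator_def inv_mult_group m_assoc)
  finally show ?thesis using assms by simp
qed

text \<open>Used to choose a finite \<open>F \<subseteq> H\<close> for which the subgroup generated by the \<open>F\<close>-translates contains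
  a prescribed finite set: an element outside this subgroup then avoids that set.\<close>
lemma (in group) finite_subset_generate:
  assumes "finite B" "B \<subseteq> generate G {\<phi> z c | z c. z \<in> A \<and> c \<in> S}"
  shows "\<exists>F. finite F \<and> F \<subseteq> A \<and> B \<subseteq> generate G {\<phi> z c | z c. z \<in> F \<and> c \<in> S}"
proof -
  define gen where "gen = (\<lambda>F. generate G {\<phi> z c | z c. z \<in> F \<and> c \<in> S})"
  have mono: "gen F \<subseteq> gen F'" if "F \<subseteq> F'" for F F'
    unfolding gen_def using that by (intro mono_generate) blast
  have single: "\<exists>F. finite F \<and> F \<subseteq> A \<and> x \<in> gen F"
    if "x \<in> generate G {\<phi> z c | z c. z \<in> A \<and> c \<in> S}" for x
    using that
  proof (induction rule: generate.induct)
    case one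
    show ?case by (intro exI[of _ "{}"]) (auto simp: gen_def intro: generate.one)
  next
    case (incl h)
    then obtain z c where "h = \<phi> z c" "z \<in> A" "c \<in> S" by auto
    then show ?case by (intro exI[of _ "{z}"]) (auto simp: gen_def intro: generate.incl)
  next
    case (inv h)
    then obtain z c where "h = \<phi> z c" "z \<in> A" "c \<in> S" by auto
    then show ?case by (intro exI[of _ "{z}"]) (auto simp: gen_def intro: generate.inv)
  next
    case (eng h1 h2)
    then obtain F1 F2 where F: "finite F1" "F1 \<subseteq> A" "h1 \<in> gen F1" "finite F2" "F2 \<subseteq> A" "h2 \<in> gen F2"
      by blast
    then have "h1 \<in> gen (F1 \<union> F2)" "h2 \<in> gen (F1 \<union> F2)"
      using mono[of F1 "F1 \<union> F2"] mono[of F2 "F1 \<union> F2"] by auto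
    then have "h1 \<otimes> h2 \<in> gen (F1 \<union> F2)" unfolding gen_def by (rule generate.eng)
    then show ?case using F by (intro exI[of _ "F1 \<union> F2"]) auto
  qed
  have "\<exists>F. finite F \<and> F \<subseteq> A \<and> B \<subseteq> gen F"
    using assms
  proof (induction B rule: finite_induct)
    case empty
    show ?case by (intro exI[of _ "{}"]) auto
  next
    case (insert x B)
    then obtain F where F: "finite F" "F \<subseteq> A" "B \<subseteq> gen F" by auto
    obtain F' where F': "finite F'" "F' \<subseteq> A" "x \<in> gen F'"
      using single insert.prems by blast
    have "insert x B \<subseteq> gen (F \<union> F')"
      using F(3) F'(3) mono[of F "F \<union> F'"] mono[of F' "F \<union> F'"] by auto
    then show ?case using F F' by (intro exI[of _ "F \<union> F'"]) auto
  qed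
  then show ?thesis by (simp add: gen_def)
qed

locale fg_semidirect =
  C: group C + H: infinite_fg_group H S\<^sub>H + G: fg_group "semidirect C H \<phi>" S
  for C :: "('c, 'm) monoid_scheme" and H :: "('h, 'k) monoid_scheme"
    and \<phi> :: "'h \<Rightarrow> 'c \<Rightarrow> 'c" and S\<^sub>H :: "'h set" and S :: "('c \<times> 'h) set" +
  assumes action: "\<phi> \<in> hom H (AutoGroup C)"
begin

abbreviation G where "G \<equiv> semidirect C H \<phi>"

lemma carrier_G: "carrier G = carrier C \<times> carrier H"
  by (simp add: semidirect_def)

lemma action_iso: "z \<in> carrier H \<Longrightarrow> \<phi> z \<in> auto C"
  using action by (auto simp: hom_def AutoGroup_def)

lemma action_closed [simp]: "z \<in> carrier H \<Longrightarrow> c \<in> carrier C \<Longrightarrow> \<phi> z c \<in> carrier C"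
  using action_iso by (fastforce simp: auto_def hom_def)

lemma action_one [simp]: "z \<in> carrier H \<Longrightarrow> \<phi> z \<one>\<^bsub>C\<^esub> = \<one>\<^bsub>C\<^esub>"
  using action_iso[of z] hom_one[OF _ C.group_axioms C.group_axioms, of "\<phi> z"] by (auto simp: auto_def)

lemma mult_fibre: "c \<in> carrier C \<Longrightarrow> z \<in> carrier H \<Longrightarrow>
    (c, z) \<otimes>\<^bsub>G\<^esub> (s, \<one>\<^bsub>H\<^esub>) = (c \<otimes>\<^bsub>C\<^esub> \<phi> z s, z)"
  by (simp add: semidirect_def)

lemma mult_base: "c \<in> carrier C \<Longrightarrow> z \<in> carrier H \<Longrightarrow>
    (c, z) \<otimes>\<^bsub>G\<^esub> (\<one>\<^bsub>C\<^esub>, t) = (c, z \<otimes>\<^bsub>H\<^esub> t)"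
  by (simp add: semidirect_def)

text \<open>Right multiplication by \<open>(\<one>, t)\<close> moves within a coset, so the energies of the restrictions are parts of one
  summable family on \<open>G\<close>.\<close>
lemma coset_energy:
  assumes p: "1 \<le> p" and f: "f \<in> Dp (ereal p) G S"
  shows "c \<in> carrier C \<Longrightarrow> (\<lambda>z. f (c, z)) \<in> Dp (ereal p) H S\<^sub>H"
    and "(\<lambda>c. H.energy p (\<lambda>z. f (c, z))) summable_on carrier C"
proof -
  have s: "(\<lambda>(c, z). \<bar>f (c, z \<otimes>\<^bsub>H\<^esub> t) - f (c, z)\<bar> powr p) summable_on (SIGMA c:carrier C. carrier H)"
    if t: "t \<in> carrier H" for t
  proof -
    have "(\<lambda>x. \<bar>f (x \<otimes>\<^bsub>G\<^esub> (\<one>\<^bsub>C\<^esub>, t)) - f x\<bar> powr p) summable_on carrier G"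
      by (rule G.Dp_translation_summable[OF f]) (use p t in \<open>auto simp: carrier_G\<close>)
    then show ?thesis unfolding carrier_G
      by (rule summable_on_cong[THEN iffD1, rotated]) (auto simp: mult_base)
  qed
  show "(\<lambda>z. f (c, z)) \<in> Dp (ereal p) H S\<^sub>H" if c: "c \<in> carrier C"
    unfolding H.Dp_iff using summable_on_SigmaD1[OF s c] by auto
  show "(\<lambda>c. H.energy p (\<lambda>z. f (c, z))) summable_on carrier C"
    unfolding H.energy_def
    by (rule has_sum_imp_summable, rule has_sum_finite_sum)
       (use summable_on_Sigma_banach[OF s] in auto)
qed

text \<open>The second conclusion is uniform on cosets: the distance of \<open>f\<close> to its limit is bounded by the energy on the
  coset, and only finitely many cosets carry a large energy.\<close>
lemma coset_limits:
  assumes p: "1 \<le> p" and f: "f \<in> Dp (ereal p) G S" and K: "K \<ge> 0"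
    and lim: "\<And>g. g \<in> Dp (ereal p) H S\<^sub>H \<Longrightarrow>
      \<exists>a. (\<forall>x\<in>carrier H. \<bar>g x - a\<bar> \<le> K * H.energy p g powr (1 / p)) \<and>
        (\<forall>e>0. finite {x \<in> carrier H. \<bar>g x - a\<bar> \<ge> e})"
  obtains a where
    "\<And>c e. c \<in> carrier C \<Longrightarrow> e > 0 \<Longrightarrow> finite {z \<in> carrier H. \<bar>f (c, z) - a c\<bar> \<ge> e}"
    "\<And>e. e > 0 \<Longrightarrow> finite {c \<in> carrier C. \<exists>z\<in>carrier H. \<bar>f (c, z) - a c\<bar> \<ge> e}"
proof -
  define E where "E = (\<lambda>c. H.energy p (\<lambda>z. f (c, z)))"
  have "\<exists>a. (\<forall>z\<in>carrier H. \<bar>f (c, z) - a\<bar> \<le> K * E c powr (1 / p)) \<and>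
      (\<forall>e>0. finite {z \<in> carrier H. \<bar>f (c, z) - a\<bar> \<ge> e})" if "c \<in> carrier C" for c
    using lim[OF coset_energy(1)[OF p f that]] by (simp add: E_def)
  then have "\<forall>c\<in>carrier C. \<exists>a. (\<forall>z\<in>carrier H. \<bar>f (c, z) - a\<bar> \<le> K * E c powr (1 / p)) \<and>
      (\<forall>e>0. finite {z \<in> carrier H. \<bar>f (c, z) - a\<bar> \<ge> e})" by blast
  from bchoice[OF this] obtain a where a: "\<And>c z. c \<in> carrier C \<Longrightarrow> z \<in> carrier H \<Longrightarrow> \<bar>f (c, z) - a c\<bar> \<le> K * E c powr (1 / p)"
    "\<And>c e. c \<in> carrier C \<Longrightarrow> e > 0 \<Longrightarrow> finite {z \<in> carrier H. \<bar>f (c, z) - a c\<bar> \<ge> e}"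
    by blast
  show ?thesis
  proof (rule that[OF a(2)])
    fix e :: real assume e: "e > 0"
    define \<delta> where "\<delta> = (e / (K + 1)) powr p"
    have \<delta>: "\<delta> > 0" using e K by (simp add: \<delta>_def)
    have "finite {c \<in> carrier C. E c \<ge> \<delta>}"
      by (rule finite_level_set_of_summable) (use \<delta> coset_energy(2)[OF p f] in \<open>auto simp: E_def\<close>)
    moreover have "{c \<in> carrier C. \<exists>z\<in>carrier H. \<bar>f (c, z) - a c\<bar> \<ge> e} \<subseteq> {c \<in> carrier C. E c \<ge> \<delta>}"
    proof clarify
      fix c z assume c: "c \<in> carrier C" "z \<in> carrier H" "\<bar>f (c, z) - a c\<bar> \<ge> e"
      have "e \<le> K * E c powr (1 / p)" using a(1)[OF c(1,2)] c(3) by linarith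
      also have "\<dots> \<le> (K + 1) * E c powr (1 / p)" by (intro mult_right_mono) auto
      finally have "e / (K + 1) \<le> E c powr (1 / p)" using K by (simp add: field_simps)
      then have "\<delta> \<le> (E c powr (1 / p)) powr p"
        unfolding \<delta>_def using p e K by (intro powr_mono2) auto
      also have "\<dots> = E c" using p by (simp add: powr_powr E_def)
      finally show "\<delta> \<le> E c" .
    qed
    ultimately show "finite {c \<in> carrier C. \<exists>z\<in>carrier H. \<bar>f (c, z) - a c\<bar> \<ge> e}"
      by (rule finite_subset[rotated])
  qed
qed

lemma fibre_increments_vanish:
  assumes p: "1 \<le> p" and f: "f \<in> Dp (ereal p) G S" and s: "s \<in> carrier C" and e: "e > 0"
  shows "finite {(c, z) \<in> carrier C \<times> carrier H. \<bar>f (c \<otimes>\<^bsub>C\<^esub> \<phi> z s, z) - f (c, z)\<bar> \<ge> e}"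
proof -
  have "finite {x \<in> carrier G. \<bar>f (x \<otimes>\<^bsub>G\<^esub> (s, \<one>\<^bsub>H\<^esub>)) - f x\<bar> \<ge> e}"
    by (rule finite_level_set_of_powr_summable[OF G.Dp_translation_summable[OF f]])
       (use p s e in \<open>auto simp: carrier_G\<close>)
  then show ?thesis
    by (rule finite_subset[rotated]) (auto simp: carrier_G mult_fibre)
qed

text \<open>With \<open>c' = c b\<close> for the generator \<open>b = \<phi> w s'\<close>, the limits at \<open>c\<close> and at \<open>c'\<close> are compared along
  the path
  \<open>(c, z)\<close>, \<open>(c u, z)\<close>, \<open>(c u, w)\<close>, \<open>(c' u, w)\<close>, \<open>(c' u, z)\<close>, \<open>(c', z)\<close>
  where \<open>u = \<phi> z s\<close> commutes with \<open>b\<close>. The first, third and last moves change \<open>f\<close> little as increments far out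
  in \<open>G\<close>; the other two stay in a coset on which \<open>f\<close> is close to its limit; at both ends \<open>z\<close> is far
  out in \<open>H\<close>.\<close>
lemma coset_limits_invariant:
  assumes p: "1 \<le> p" and f: "f \<in> Dp (ereal p) G S"
    and SC: "finite S\<^sub>C" "S\<^sub>C \<subseteq> carrier C"
    and gen: "generate C {\<phi> z c | z c. z \<in> carrier H \<and> c \<in> S\<^sub>C} = carrier C"
    and far: "\<And>F. finite F \<Longrightarrow> F \<subseteq> carrier H \<Longrightarrow>
      infinite {z \<in> carrier H. \<exists>s\<in>S\<^sub>C.
        \<phi> z s \<notin> generate C {\<phi> w c | w c. w \<in> F \<and> c \<in> S\<^sub>C} \<and>
        (\<forall>w\<in>F. \<forall>s'\<in>S\<^sub>C. commutator C (\<phi> z s) (\<phi> w s') = \<one>\<^bsub>C\<^esub>)}"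
    and a: "\<And>c e. c \<in> carrier C \<Longrightarrow> e > 0 \<Longrightarrow> finite {z \<in> carrier H. \<bar>f (c, z) - a c\<bar> \<ge> e}"
      "\<And>e. e > 0 \<Longrightarrow> finite {c \<in> carrier C. \<exists>z\<in>carrier H. \<bar>f (c, z) - a c\<bar> \<ge> e}"
    and c: "c \<in> carrier C" and w: "w \<in> carrier H" and s': "s' \<in> S\<^sub>C"
  shows "a (c \<otimes>\<^bsub>C\<^esub> \<phi> w s') = a c"
proof -
  define b where "b = \<phi> w s'"
  define c' where "c' = c \<otimes>\<^bsub>C\<^esub> b"
  have b: "b \<in> carrier C" using w s' SC by (auto simp: b_def)
  have c': "c' \<in> carrier C" using b c by (simp add: c'_def)
  have close: "\<bar>a c' - a c\<bar> \<le> e" if e: "e > 0" for e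
  proof -
    define \<delta> where "\<delta> = e / 9"
    have \<delta>: "\<delta> > 0" using e by (simp add: \<delta>_def)
    define X where "X = {c \<in> carrier C. \<exists>z\<in>carrier H. \<bar>f (c, z) - a c\<bar> \<ge> \<delta>}"
    define Y where "Y = (\<Union>s\<in>S\<^sub>C. {(c, z) \<in> carrier C \<times> carrier H. \<bar>f (c \<otimes>\<^bsub>C\<^esub> \<phi> z s, z) - f (c, z)\<bar> \<ge> \<delta>})"
    have X: "finite X" "X \<subseteq> carrier C" unfolding X_def using a(2)[OF \<delta>] by auto
    have Y: "finite Y"
      unfolding Y_def using SC(2) by (intro finite_UN_I[OF SC(1)] fibre_increments_vanish[OF p f _ \<delta>]) blast
    have D: "X \<union> fst ` Y \<subseteq> carrier C" using X(2) by (auto simp: Y_def)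
    \<comment> \<open>If \<open>u\<close> is not in \<open>B\<close>, then the cosets of \<open>c u\<close> and \<open>c' u\<close> are good: the energy there is small, and so
        are the increments leaving them.\<close>
    define B where "B = (\<lambda>x. inv\<^bsub>C\<^esub> c \<otimes>\<^bsub>C\<^esub> x) ` (X \<union> fst ` Y) \<union> (\<lambda>x. inv\<^bsub>C\<^esub> c' \<otimes>\<^bsub>C\<^esub> x) ` (X \<union> fst ` Y)"
    have "finite B" using X Y by (simp add: B_def)
    moreover have "B \<subseteq> generate C {\<phi> z c | z c. z \<in> carrier H \<and> c \<in> S\<^sub>C}"
      unfolding gen B_def using subsetD[OF D] c c' by (intro Un_least image_subsetI C.m_closed C.inv_closed)
    ultimately have "\<exists>F. finite F \<and> F \<subseteq> carrier H \<and> B \<subseteq> generate C {\<phi> z c | z c. z \<in> F \<and> c \<in> S\<^sub>C}"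
      by (rule C.finite_subset_generate)
    then obtain F0 where F0: "finite F0" "F0 \<subseteq> carrier H" "B \<subseteq> generate C {\<phi> z c | z c. z \<in> F0 \<and> c \<in> S\<^sub>C}"
      by blast
    define F where "F = insert w F0"
    have F: "finite F" "F \<subseteq> carrier H" "w \<in> F" using F0 w by (auto simp: F_def)
    have BF: "B \<subseteq> generate C {\<phi> z c | z c. z \<in> F \<and> c \<in> S\<^sub>C}"
      by (rule subset_trans[OF F0(3) C.mono_generate]) (unfold F_def, blast)
    \<comment> \<open>Points of \<open>H\<close> over which \<open>f\<close> is not yet close to the two limits, or changes too much when leaving a coset.\<close>
    define Z where "Z = {z \<in> carrier H. \<bar>f (c, z) - a c\<bar> \<ge> \<delta>} \<union> {z \<in> carrier H. \<bar>f (c', z) - a c'\<bar> \<ge> \<delta>} \<union> snd ` Y"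
    have "finite Z" unfolding Z_def using a(1)[OF c \<delta>] a(1)[OF c' \<delta>] Y by simp
    define R where "R = {z \<in> carrier H. \<exists>s\<in>S\<^sub>C.
        \<phi> z s \<notin> generate C {\<phi> w c | w c. w \<in> F \<and> c \<in> S\<^sub>C} \<and>
        (\<forall>w\<in>F. \<forall>s'\<in>S\<^sub>C. commutator C (\<phi> z s) (\<phi> w s') = \<one>\<^bsub>C\<^esub>)}"
    have "infinite (R - Z)"
      by (rule Diff_infinite_finite[OF \<open>finite Z\<close>]) (unfold R_def, rule far[OF F(1,2)])
    then have "R - Z \<noteq> {}" by (rule infinite_imp_nonempty)
    then obtain z where zR: "z \<in> R" and zZ: "z \<notin> Z" by blast
    have z: "z \<in> carrier H" using zR by (simp add: R_def)
    obtain s where s: "s \<in> S\<^sub>C"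
      and new: "\<phi> z s \<notin> generate C {\<phi> w c | w c. w \<in> F \<and> c \<in> S\<^sub>C}"
      and comm: "\<forall>w\<in>F. \<forall>s'\<in>S\<^sub>C. commutator C (\<phi> z s) (\<phi> w s') = \<one>\<^bsub>C\<^esub>"
      using zR unfolding R_def mem_Collect_eq by (elim conjE bexE)
    define u where "u = \<phi> z s"
    have u: "u \<in> carrier C" using z s SC by (auto simp: u_def)
    have ub: "u \<otimes>\<^bsub>C\<^esub> b = b \<otimes>\<^bsub>C\<^esub> u"
      using C.commute_of_commutator_one[OF u b] comm[rule_format, OF F(3) s'] by (simp add: u_def b_def)
    have cu: "c \<otimes>\<^bsub>C\<^esub> u \<in> carrier C" "c' \<otimes>\<^bsub>C\<^esub> u \<in> carrier C" using c c' u by auto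
    have avoid: "x \<otimes>\<^bsub>C\<^esub> u \<notin> X \<union> fst ` Y" if "x = c \<or> x = c'" for x
    proof
      assume "x \<otimes>\<^bsub>C\<^esub> u \<in> X \<union> fst ` Y"
      then have "inv\<^bsub>C\<^esub> x \<otimes>\<^bsub>C\<^esub> (x \<otimes>\<^bsub>C\<^esub> u) \<in> B" using that unfolding B_def by blast
      moreover have "inv\<^bsub>C\<^esub> x \<otimes>\<^bsub>C\<^esub> (x \<otimes>\<^bsub>C\<^esub> u) = u"
        using that c c' u by (auto simp: C.m_assoc[symmetric])
      ultimately show False using BF new by (auto simp: u_def)
    qed
    have near: "\<bar>f (x \<otimes>\<^bsub>C\<^esub> u, y) - a (x \<otimes>\<^bsub>C\<^esub> u)\<bar> < \<delta>" if "x = c \<or> x = c'" "y \<in> carrier H" for x y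
    proof -
      have "x \<otimes>\<^bsub>C\<^esub> u \<notin> X" "x \<otimes>\<^bsub>C\<^esub> u \<in> carrier C" using avoid[OF that(1)] that(1) cu by auto
      then have "\<not> \<delta> \<le> \<bar>f (x \<otimes>\<^bsub>C\<^esub> u, y) - a (x \<otimes>\<^bsub>C\<^esub> u)\<bar>" using that(2) unfolding X_def by blast
      then show ?thesis by simp
    qed
    have stepw: "\<bar>f (c \<otimes>\<^bsub>C\<^esub> u \<otimes>\<^bsub>C\<^esub> \<phi> w s', w) - f (c \<otimes>\<^bsub>C\<^esub> u, w)\<bar> < \<delta>"
    proof (rule ccontr)
      assume "\<not> ?thesis"
      then have "\<delta> \<le> \<bar>f (c \<otimes>\<^bsub>C\<^esub> u \<otimes>\<^bsub>C\<^esub> \<phi> w s', w) - f (c \<otimes>\<^bsub>C\<^esub> u, w)\<bar>" by simp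
      then have "(c \<otimes>\<^bsub>C\<^esub> u, w) \<in> Y" unfolding Y_def using cu(1) w s' by blast
      then have "c \<otimes>\<^bsub>C\<^esub> u \<in> fst ` Y" by (rule image_eqI[rotated]) simp
      then show False using avoid[of c] by blast
    qed
    have stepz: "\<bar>f (x \<otimes>\<^bsub>C\<^esub> u, z) - f (x, z)\<bar> < \<delta>" if "x = c \<or> x = c'" for x
    proof (rule ccontr)
      assume "\<not> ?thesis"
      then have "\<delta> \<le> \<bar>f (x \<otimes>\<^bsub>C\<^esub> \<phi> z s, z) - f (x, z)\<bar>" by (simp add: u_def)
      moreover have "x \<in> carrier C" using that c c' by blast
      ultimately have "(x, z) \<in> Y" unfolding Y_def using z s by blast
      then have "z \<in> snd ` Y" by (rule image_eqI[rotated]) simp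
      then show False using zZ by (simp add: Z_def)
    qed
    have end_z: "\<bar>f (c, z) - a c\<bar> < \<delta>" "\<bar>f (c', z) - a c'\<bar> < \<delta>"
      using z zZ by (auto simp: Z_def)
    have "c \<otimes>\<^bsub>C\<^esub> u \<otimes>\<^bsub>C\<^esub> \<phi> w s' = c' \<otimes>\<^bsub>C\<^esub> u"
      using c b u ub by (simp add: c'_def b_def[symmetric] C.m_assoc)
    then have "\<bar>f (c' \<otimes>\<^bsub>C\<^esub> u, w) - f (c \<otimes>\<^bsub>C\<^esub> u, w)\<bar> < \<delta>" using stepw by simp
    then have "a c' - a c < 9 * \<delta> \<and> - (a c' - a c) < 9 * \<delta>"
      using near[OF disjI1[OF refl] z] near[OF disjI1[OF refl] w]
        near[OF disjI2[OF refl] z] near[OF disjI2[OF refl] w]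
        stepz[OF disjI1[OF refl]] stepz[OF disjI2[OF refl]] end_z
      unfolding abs_less_iff by (elim conjE, intro conjI; linarith)
    then show ?thesis by (simp add: \<delta>_def abs_le_iff less_imp_le)
  qed
  have "\<bar>a c' - a c\<bar> \<le> 0" by (rule field_le_epsilon) (use close in simp)
  then show ?thesis by (simp add: c'_def b_def)
qed

text \<open>The limits along cosets do not change under the generators of \<open>C\<close>, so they agree, and \<open>f\<close> minus the
  common limit vanishes at infinity.\<close>
theorem harmonic_Dp_constant:
  assumes p: "1 \<le> p" and f: "f \<in> HDp (ereal p) G S"
    and SC: "finite S\<^sub>C" "S\<^sub>C \<subseteq> carrier C"
    and gen: "generate C {\<phi> z c | z c. z \<in> carrier H \<and> c \<in> S\<^sub>C} = carrier C"
    and far: "\<And>F. finite F \<Longrightarrow> F \<subseteq> carrier H \<Longrightarrow>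
      infinite {z \<in> carrier H. \<exists>s\<in>S\<^sub>C.
        \<phi> z s \<notin> generate C {\<phi> w c | w c. w \<in> F \<and> c \<in> S\<^sub>C} \<and>
        (\<forall>w\<in>F. \<forall>s'\<in>S\<^sub>C. commutator C (\<phi> z s) (\<phi> w s') = \<one>\<^bsub>C\<^esub>)}"
    and K: "K \<ge> 0"
    and lim: "\<And>g. g \<in> Dp (ereal p) H S\<^sub>H \<Longrightarrow>
      \<exists>a. (\<forall>x\<in>carrier H. \<bar>g x - a\<bar> \<le> K * H.energy p g powr (1 / p)) \<and>
        (\<forall>e>0. finite {x \<in> carrier H. \<bar>g x - a\<bar> \<ge> e})"
  shows "f constant_on carrier G"
proof -
  have fD: "f \<in> Dp (ereal p) G S" and harm: "f \<in> harmonic G S" using f by (auto simp: HDp_def)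
  obtain a where a: "\<And>c e. c \<in> carrier C \<Longrightarrow> e > 0 \<Longrightarrow> finite {z \<in> carrier H. \<bar>f (c, z) - a c\<bar> \<ge> e}"
    "\<And>e. e > 0 \<Longrightarrow> finite {c \<in> carrier C. \<exists>z\<in>carrier H. \<bar>f (c, z) - a c\<bar> \<ge> e}"
    using coset_limits[OF p fD K lim] by blast
  have a_shift: "a (c \<otimes>\<^bsub>C\<^esub> \<phi> w s') = a c" if "c \<in> carrier C" "w \<in> carrier H" "s' \<in> S\<^sub>C" for c w s'
    by (rule coset_limits_invariant[OF p fD SC gen far a that])
  define T where "T = {\<phi> z c | z c. z \<in> carrier H \<and> c \<in> S\<^sub>C}"
  have T: "T \<subseteq> carrier C" using SC by (auto simp: T_def)
  have shift: "\<forall>c\<in>carrier C. a (c \<otimes>\<^bsub>C\<^esub> x) = a c" if "x \<in> generate C T" for x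
    using that
  proof (induction rule: generate.induct)
    case (incl h)
    then show ?case using a_shift by (auto simp: T_def)
  next
    case (inv h)
    show ?case
    proof
      fix c assume c: "c \<in> carrier C"
      have h: "h \<in> carrier C" using inv T by auto
      have "a (c \<otimes>\<^bsub>C\<^esub> inv\<^bsub>C\<^esub> h) = a (c \<otimes>\<^bsub>C\<^esub> inv\<^bsub>C\<^esub> h \<otimes>\<^bsub>C\<^esub> h)"
      proof -
        obtain w s' where "h = \<phi> w s'" "w \<in> carrier H" "s' \<in> S\<^sub>C" using inv by (auto simp: T_def)
        then show ?thesis using a_shift[of "c \<otimes>\<^bsub>C\<^esub> inv\<^bsub>C\<^esub> h" w s'] c h by simp
      qed
      then show "a (c \<otimes>\<^bsub>C\<^esub> inv\<^bsub>C\<^esub> h) = a c" using c h by (simp add: C.m_assoc)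
    qed
  next
    case (eng h1 h2)
    have "h1 \<in> carrier C" "h2 \<in> carrier C" using eng C.generate_in_carrier[OF T] by auto
    then show ?case using eng by (simp add: C.m_assoc[symmetric])
  qed simp
  have const: "a c = a \<one>\<^bsub>C\<^esub>" if "c \<in> carrier C" for c
  proof -
    have "a (\<one>\<^bsub>C\<^esub> \<otimes>\<^bsub>C\<^esub> c) = a \<one>\<^bsub>C\<^esub>" using shift[of c] that gen C.one_closed unfolding T_def by blast
    then show ?thesis using that by simp
  qed
  show ?thesis
  proof (rule G.harmonic_vanishing_at_infinity[OF harm, of "a \<one>\<^bsub>C\<^esub>"])
    fix e :: real assume e: "e > 0"
    have "{x \<in> carrier G. \<bar>f x - a \<one>\<^bsub>C\<^esub>\<bar> \<ge> e}
      \<subseteq> (SIGMA c : {c \<in> carrier C. \<exists>z\<in>carrier H. \<bar>f (c, z) - a c\<bar> \<ge> e}. {z \<in> carrier H. \<bar>f (c, z) - a c\<bar> \<ge> e})"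
    proof
      fix x assume x: "x \<in> {x \<in> carrier G. \<bar>f x - a \<one>\<^bsub>C\<^esub>\<bar> \<ge> e}"
      obtain c z where cz: "x = (c, z)" by (cases x)
      have cz': "c \<in> carrier C" "z \<in> carrier H" "\<bar>f (c, z) - a \<one>\<^bsub>C\<^esub>\<bar> \<ge> e"
        using x by (auto simp: cz carrier_G)
      have "\<bar>f (c, z) - a c\<bar> \<ge> e" using cz'(3) by (subst const[OF cz'(1)])
      then show "x \<in> (SIGMA c : {c \<in> carrier C. \<exists>z\<in>carrier H. \<bar>f (c, z) - a c\<bar> \<ge> e}. {z \<in> carrier H. \<bar>f (c, z) - a c\<bar> \<ge> e})"
        unfolding cz using cz' by blast
    qed
    then show "finite {x \<in> carrier G. \<bar>f x - a \<one>\<^bsub>C\<^esub>\<bar> \<ge> e}"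
      by (rule finite_subset) (intro finite_SigmaI a e, auto)
  qed
qed

end

theorem theorem1:
  fixes p d :: real
    and C :: "('c, 'm) monoid_scheme"
    and H :: "('h, 'k) monoid_scheme"
    and \<phi> :: "'h \<Rightarrow> 'c \<Rightarrow> 'c"
    and S\<^sub>H :: "'h set"
    and S\<^sub>C :: "'c set"
  assumes "1 \<le> p"
    and "group H" and "finite S\<^sub>H" and "generates H S\<^sub>H"
    and "growth_at_least_degree H S\<^sub>H d" and "d > 2 * p"
    and "superpolynomial_growth H S\<^sub>H \<Longrightarrow>
      \<exists>q>ereal p. \<forall>f \<in> HDp q H S\<^sub>H \<inter> ell \<infinity> (carrier H). f constant_on carrier H"
    and "group C" and "\<not> finitely_generated C"
    and "\<phi> \<in> hom H (AutoGroup C)"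
    and "finitely_generated (semidirect C H \<phi>)"
    and "finite S\<^sub>C" and "S\<^sub>C \<subseteq> carrier C"
    and "generate C {\<phi> z c | z c. z \<in> carrier H \<and> c \<in> S\<^sub>C} = carrier C"
    and "\<And>F. finite F \<Longrightarrow> F \<subseteq> carrier H \<Longrightarrow>
      infinite {z \<in> carrier H. \<exists>s\<in>S\<^sub>C.
        \<phi> z s \<notin> generate C {\<phi> w c | w c. w \<in> F \<and> c \<in> S\<^sub>C} \<and>
        (\<forall>w\<in>F. \<forall>s'\<in>S\<^sub>C. commutator C (\<phi> z s) (\<phi> w s') = \<one>\<^bsub>C\<^esub>)}"
  shows "\<forall>S. finite S \<and> generates (semidirect C H \<phi>) S \<longrightarrow>
    (\<forall>f \<in> HDp (ereal p) (semidirect C H \<phi>) S. f constant_on carrier (semidirect C H \<phi>))"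
proof (intro allI impI ballI)
  fix S f
  assume S: "finite S \<and> generates (semidirect C H \<phi>) S"
    and f: "f \<in> HDp (ereal p) (semidirect C H \<phi>) S"
  interpret HG: group H by fact
  interpret CG: group C by fact
  interpret GG: group "semidirect C H \<phi>" by (rule group_semidirect) fact+
  have "infinite (carrier H)"
    using assms(15)[of "{}"] by (auto elim!: contrapos_nn intro: finite_subset[rotated])
  then interpret HS: infinite_fg_group H S\<^sub>H
    by unfold_locales (use assms in auto)
  interpret fg_semidirect C H \<phi> S\<^sub>H S
    by unfold_locales (use S assms in auto)
  obtain K where K: "K \<ge> 0" "\<And>g. g \<in> Dp (ereal p) H S\<^sub>H \<Longrightarrow>
      \<exists>a. (\<forall>x\<in>carrier H. \<bar>g x - a\<bar> \<le> K * HS.energy p g powr (1 / p)) \<and>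
        (\<forall>e>0. finite {x \<in> carrier H. \<bar>g x - a\<bar> \<ge> e})"
    using HS.limit_at_infinity[OF assms(1,5,6,7)] by blast
  show "f constant_on carrier (semidirect C H \<phi>)"
    by (rule harmonic_Dp_constant[OF assms(1) f assms(12,13,14,15) K])
qed

end
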